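(* Let $V:\mathbb{H}^2\to \mathrm{T}\mathbb{H}^2$ be a smooth vector field on $\mathbb{H}^2$. The following are equivalent: (1) There exists a smooth function $u:\mathbb{H}^2\to\mathbb{R}$ such that $V$ is the vector field associated with the surface $S=\mathrm{gr}(u)$ in Half-Pipe space, that is $V=V_S$. (2) $V(\mathbb{H}^2)$ is a Lagrangian surface in $\mathrm{T}\mathbb{H}^2$ with respect to the symplectic form $\Omega$ (i.e. $V^*\Omega=0$). (3) $V$ is a divergence-free vector field on $\mathbb{H}^2$.
   Context: Minkowski space $\mathbb{R}^{1,2}$ is $\mathbb{R}^3$ with $\langle x,y\rangle_{1,2}=-x_0y_0+x_1y_1+x_2y_2$. The hyperbolic plane is $\mathbb{H}^2=\{x\in\mathbb{R}^{1,2}: \langle x,x\rangle_{1,2}=-1,\ x_0>0\}$ with the induced Riemannian metric $g$ and Levi-Civita connection $\nabla$. For $x,y\in\mathbb{R}^{1,2}$, $x\boxtimes y$ is the unique vector with $\langle x\boxtimes y,v\rangle_{1,2}=\det(x,y,v)$ for all $v$. The complex structure on $\mathbb{H}^2$ is $\mathrm{J}_p(v)=p\boxtimes v$, $v\in \mathrm{T}_p\mathbb{H}^2$. The divergence is $\mathrm{div}(V)=\mathrm{tr}(\nabla V)$; $V$ is divergence-free if $\mathrm{div}(V)=0$. Surfaces in Half-Pipe space. Let $\mathbb{D}^2\subset\mathbb{R}^2$ be the open unit disk and $\Pi:\mathbb{H}^2\to\mathbb{D}^2$, $\Pi(x_0,x_1,x_2)=(x_1/x_0,x_2/x_0)$.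 Half-Pipe space $\mathbb{HP}^3$ is identified with $\mathbb{H}^2\times\mathbb{R}$, and its Klein model is $\mathbb{D}^2\times\mathbb{R}$; the graph $\mathrm{gr}(u)$ of $u:\mathbb{H}^2\to\mathbb{R}$ corresponds in the Klein model to the graph of $\overline{u}:\mathbb{D}^2\to\mathbb{R}$ defined by $\overline{u}(\eta)=\sqrt{1-|\eta|^2}\,u(\Pi^{-1}(\eta))$. For $\sigma\in\mathbb{R}^{1,2}$ let $\mathrm{P}_\sigma=\{(\eta,t)\in\mathbb{D}^2\times\mathbb{R}: \langle(1,\eta),\sigma\rangle_{1,2}=t\}$; every non-vertical plane is $\mathrm{P}_\sigma$ for a unique $\sigma$. For smooth $u$ and $S=\mathrm{gr}(u)$, the vector field $V_S$ associated with $S$ is defined by $V_S(p)=p\boxtimes\sigma_p$, where $\sigma_p\in\mathbb{R}^{1,2}$ is the vector such that $\mathrm{P}_{\sigma_p}$ is the tangent plane of $\mathrm{gr}(\overline{u})$ at $(\Pi(p),\overline{u}(\Pi(p)))$. Geometry of $\mathrm{T}\mathbb{H}^2$. For $(x,v)\in \mathrm{T}\mathbb{H}^2$, identify $\mathrm{T}_x\mathbb{H}^2\times \mathrm{T}_x\mathbb{H}^2\cong \mathrm{T}_{(x,v)}\mathrm{T}\mathbb{H}^2$ by $(w_1,w_2)\mapsto w_1^{\mathcal{H}}+w_2^{\mathcal{V}}$, where $w_2^{\mathcal V}=\frac{d}{dt}|_{t=0}(x,v+tw_2)$ is the vertical lift and $w_1^{\mathcal H}=\frac{d}{dt}|_{t=0}(c(t),W(t))$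 is the horizontal lift ($c$ the geodesic with $c(0)=x$, $c'(0)=w_1$, and $W$ the parallel field along $c$ with $W(0)=v$). The symplectic form is $\Omega((X_1,X_2),(Y_1,Y_2))=g(\mathrm{J}X_1,Y_2)-g(X_2,\mathrm{J}Y_1)$. *)

theory Defs
  imports "HOL-Analysis.Analysis"
begin

section \<open>Minkowski space and the hyperbolic plane\<close>

text \<open>
  Minkowski space is the type \<open>real ^ 3\<close>; the coordinates $x_0, x_1, x_2$ are
  \<open>x $ 1\<close>, \<open>x $ 2\<close>, \<open>x $ 3\<close>. On tangent vectors of the hyperbolic plane
  \<open>mink\<close> is the induced Riemannian metric.
\<close>

definition mink :: "real ^ 3 \<Rightarrow> real ^ 3 \<Rightarrow> real" where
  "mink x y = - (x $ 1 * y $ 1) + x $ 2 * y $ 2 + x $ 3 * y $ 3"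

definition mcross :: "real ^ 3 \<Rightarrow> real ^ 3 \<Rightarrow> real ^ 3"  (infixl "\<boxtimes>" 75) where
  "x \<boxtimes> y = (THE z. \<forall>v. mink z v = det (vector [x, y, v] :: real ^ 3 ^ 3))"

definition hyp2 :: "(real ^ 3) set" where
  "hyp2 = {x. mink x x = - 1 \<and> x $ 1 > 0}"

definition tspace :: "real ^ 3 \<Rightarrow> (real ^ 3) set" where
  "tspace p = {v. mink p v = 0}"

definition cpx :: "real ^ 3 \<Rightarrow> real ^ 3 \<Rightarrow> real ^ 3" where
  "cpx p v = p \<boxtimes> v"

definition tang :: "real ^ 3 \<Rightarrow> real ^ 3 \<Rightarrow> real ^ 3" where
  "tang p v = v + mink p v *\<^sub>R p"
  \<comment> \<open>for \<open>p \<in> hyp2\<close>: the \<open>mink\<close>-orthogonal projection onto the tangent space at \<open>p\<close>\<close>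


section \<open>Smoothness\<close>

primrec Ck_on :: "nat \<Rightarrow> 'a::euclidean_space set \<Rightarrow> ('a \<Rightarrow> 'b::euclidean_space) \<Rightarrow> bool" where
  "Ck_on 0 U f \<longleftrightarrow> continuous_on U f"
| "Ck_on (Suc k) U f \<longleftrightarrow> (\<forall>x\<in>U. f differentiable at x) \<and>
     (\<forall>v. Ck_on k U (\<lambda>x. frechet_derivative f (at x) v))"
  \<comment> \<open>only meaningful for open \<open>U\<close>\<close>

definition smooth_map :: "'a::euclidean_space set \<Rightarrow> ('a \<Rightarrow> 'b::euclidean_space) \<Rightarrow> bool" where
  "smooth_map X f \<longleftrightarrow> (\<forall>x\<in>X. \<exists>U F. open U \<and> x \<in> U \<and> (\<forall>k. Ck_on k U F) \<and> (\<forall>y\<in>X \<inter> U. F y = f y))"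
  \<comment> \<open>the usual notion for an arbitrary subset \<open>X\<close> of a Euclidean space: smooth local extensions exist\<close>

definition smooth_field :: "(real ^ 3 \<Rightarrow> real ^ 3) \<Rightarrow> bool" where
  "smooth_field V \<longleftrightarrow> smooth_map hyp2 V \<and> (\<forall>p\<in>hyp2. V p \<in> tspace p)"
  \<comment> \<open>the section itself is \<open>\<lambda>p. (p, V p)\<close>; values of \<open>V\<close> off \<open>hyp2\<close> are irrelevant\<close>


section \<open>Levi-Civita connection and divergence\<close>

text \<open>
  Derivatives of maps that are given on \<open>hyp2\<close> only are Frechet derivatives
  within \<open>hyp2\<close>. Such a derivative is determined only on tangent vectors (lemma
  \<open>frechet_derivative_hyp2\<close> below), and it is only ever applied to those.
\<close>

definition dhyp :: "(real ^ 3 \<Rightarrow> 'b::real_normed_vector) \<Rightarrow> real ^ 3 \<Rightarrow> real ^ 3 \<Rightarrow> 'b" where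
  "dhyp f p = frechet_derivative f (at p within hyp2)"

text \<open>
  The Levi-Civita connection of a submanifold is the tangential part of the ambient flat
  connection; lemmas \<open>lc_conn_metric\<close> and \<open>lc_conn_torsion_free\<close> below are the
  two properties that characterise it.
\<close>

definition lc_conn :: "(real ^ 3 \<Rightarrow> real ^ 3) \<Rightarrow> real ^ 3 \<Rightarrow> real ^ 3 \<Rightarrow> real ^ 3" where
  "lc_conn V p w = tang p (dhyp V p w)"

definition trace_on :: "'a::real_vector set \<Rightarrow> ('a \<Rightarrow> 'a) \<Rightarrow> real" where
  "trace_on T A = (let B = (SOME B. independent B \<and> span B = T)
     in \<Sum>b\<in>B. representation B (A b) b)"
  \<comment> \<open>trace of an endomorphism \<open>A\<close> of the finite-dimensional subspace \<open>T\<close>, in an arbitrary basis\<close>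

definition divergence :: "(real ^ 3 \<Rightarrow> real ^ 3) \<Rightarrow> real ^ 3 \<Rightarrow> real" where
  "divergence V p = trace_on (tspace p) (lc_conn V p)"


section \<open>Surfaces in Half-Pipe space\<close>

text \<open>The Klein model is \<open>ball 0 1 \<times> UNIV\<close>, a subset of \<open>(real ^ 2) \<times> real\<close>.\<close>

definition klein_proj :: "real ^ 3 \<Rightarrow> real ^ 2" where
  "klein_proj x = vector [x $ 2 / x $ 1, x $ 3 / x $ 1]"

definition klein_fun :: "(real ^ 3 \<Rightarrow> real) \<Rightarrow> real ^ 2 \<Rightarrow> real" where
  "klein_fun u \<eta> = sqrt (1 - (norm \<eta>)\<^sup>2) * u (inv_into hyp2 klein_proj \<eta>)"

definition plane :: "real ^ 3 \<Rightarrow> ((real ^ 2) \<times> real) set" where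
  "plane \<sigma> = {(\<eta>, t). \<eta> \<in> ball 0 1 \<and> mink (vector [1, \<eta> $ 1, \<eta> $ 2]) \<sigma> = t}"

definition graph_tangent_plane :: "(real ^ 2 \<Rightarrow> real) \<Rightarrow> real ^ 2 \<Rightarrow> ((real ^ 2) \<times> real) set" where
  "graph_tangent_plane f \<eta>0 =
     {(\<eta>, t). \<eta> \<in> ball 0 1 \<and> t = f \<eta>0 + frechet_derivative f (at \<eta>0) (\<eta> - \<eta>0)}"

definition assoc_field :: "(real ^ 3 \<Rightarrow> real) \<Rightarrow> real ^ 3 \<Rightarrow> real ^ 3" where
  "assoc_field u p =
     p \<boxtimes> (THE \<sigma>. plane \<sigma> = graph_tangent_plane (klein_fun u) (klein_proj p))"


section \<open>The symplectic form on the tangent bundle\<close>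

text \<open>
  The tangent bundle of \<open>hyp2\<close> is the set of pairs \<open>(x, v)\<close> with \<open>x \<in> hyp2\<close>,
  \<open>v \<in> tspace x\<close>; its tangent vectors at \<open>(x, v)\<close> are vectors of \<open>(real ^ 3) \<times> (real ^ 3)\<close>,
  namely those in the image of \<open>tspace x \<times> tspace x\<close> under \<open>tb_iso x v\<close>. The differential
  of a section \<open>\<lambda>q. (q, V q)\<close> takes its values there.
\<close>

definition cov_deriv :: "(real \<Rightarrow> real ^ 3) \<Rightarrow> (real \<Rightarrow> real ^ 3) \<Rightarrow> real \<Rightarrow> real ^ 3" where
  "cov_deriv c W t = tang (c t) (vector_derivative W (at t))"

definition geodesic :: "(real \<Rightarrow> real ^ 3) \<Rightarrow> bool" where
  "geodesic c \<longleftrightarrow> smooth_map UNIV c \<and> range c \<subseteq> hyp2 \<and>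
     (\<forall>t. cov_deriv c (\<lambda>s. vector_derivative c (at s)) t = 0)"

definition parallel_along :: "(real \<Rightarrow> real ^ 3) \<Rightarrow> (real \<Rightarrow> real ^ 3) \<Rightarrow> bool" where
  "parallel_along c W \<longleftrightarrow> smooth_map UNIV W \<and> (\<forall>t. W t \<in> tspace (c t)) \<and> (\<forall>t. cov_deriv c W t = 0)"

definition vlift :: "real ^ 3 \<Rightarrow> real ^ 3 \<Rightarrow> real ^ 3 \<Rightarrow> (real ^ 3) \<times> (real ^ 3)" where
  "vlift x v w = vector_derivative (\<lambda>t. (x, v + t *\<^sub>R w)) (at 0)"

definition hlift :: "real ^ 3 \<Rightarrow> real ^ 3 \<Rightarrow> real ^ 3 \<Rightarrow> (real ^ 3) \<times> (real ^ 3)" where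
  "hlift x v w = (THE \<xi>. \<exists>c W. geodesic c \<and> c 0 = x \<and> vector_derivative c (at 0) = w \<and>
     parallel_along c W \<and> W 0 = v \<and> \<xi> = vector_derivative (\<lambda>t. (c t, W t)) (at 0))"

definition tb_iso :: "real ^ 3 \<Rightarrow> real ^ 3 \<Rightarrow> (real ^ 3) \<times> (real ^ 3) \<Rightarrow> (real ^ 3) \<times> (real ^ 3)" where
  "tb_iso x v = (\<lambda>(w1, w2). hlift x v w1 + vlift x v w2)"

definition Omega ::
  "(real ^ 3) \<times> (real ^ 3) \<Rightarrow> (real ^ 3) \<times> (real ^ 3) \<Rightarrow> (real ^ 3) \<times> (real ^ 3) \<Rightarrow> real" where
  "Omega = (\<lambda>(x, v) \<xi> \<zeta>.
     let (X1, X2) = inv_into (tspace x \<times> tspace x) (tb_iso x v) \<xi>;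
         (Y1, Y2) = inv_into (tspace x \<times> tspace x) (tb_iso x v) \<zeta>
     in mink (cpx x X1) Y2 - mink X2 (cpx x Y1))"

definition pullback_Omega :: "(real ^ 3 \<Rightarrow> real ^ 3) \<Rightarrow> real ^ 3 \<Rightarrow> real ^ 3 \<Rightarrow> real ^ 3 \<Rightarrow> real" where
  "pullback_Omega V p w1 w2 =
     Omega (p, V p) (dhyp (\<lambda>q. (q, V q)) p w1) (dhyp (\<lambda>q. (q, V q)) p w2)"


section \<open>The definitions by description are meaningful\<close>

lemma bounded_bilinear_mink: "bounded_bilinear mink"
proof -
  have eq: "mink x y = x \<bullet> y - 2 * ((x \<bullet> axis 1 1) * (y \<bullet> axis 1 1))" for x y
    by (simp add: mink_def inner_vec_def sum_3 axis_def)
  have 1: "bounded_bilinear (\<lambda>(x::real ^ 3) (y::real ^ 3). (x \<bullet> axis 1 1) * (y \<bullet> axis 1 1))"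
    by (rule bounded_bilinear.comp[OF bounded_bilinear_mult bounded_linear_inner_left bounded_linear_inner_left])
  show ?thesis
    unfolding eq[abs_def] bounded_bilinear_def
  proof (safe, goal_cases)
    case 5
    obtain K where K: "\<And>(a::real ^ 3) (b::real ^ 3). norm ((a \<bullet> axis 1 1) * (b \<bullet> axis 1 1)) \<le> norm a * norm b * K"
      using bounded_bilinear.bounded[OF 1] by blast
    have "norm (a \<bullet> b - 2 * ((a \<bullet> axis 1 1) * (b \<bullet> axis 1 1))) \<le> norm a * norm b * (1 + 2 * K)"
      for a b :: "real ^ 3"
    proof -
      have "\<bar>(a \<bullet> axis 1 1) * (b \<bullet> axis 1 1)\<bar> \<le> norm a * norm b * K" using K[of a b] by simp
      then have "\<bar>a \<bullet> b - 2 * ((a \<bullet> axis 1 1) * (b \<bullet> axis 1 1))\<bar> \<le> norm a * norm b + 2 * (norm a * norm b * K)"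
        using Cauchy_Schwarz_ineq2[of a b] by linarith
      then show ?thesis by (simp add: algebra_simps)
    qed
    then show ?case by blast
  qed (simp_all add: inner_add_left inner_add_right algebra_simps)
qed

interpretation mink: bounded_bilinear mink
  by (rule bounded_bilinear_mink)

lemmas mink_simps = mink.add_left mink.add_right mink.diff_left mink.diff_right
  mink.scaleR_left mink.scaleR_right mink.zero_left mink.zero_right mink.minus_left mink.minus_right

lemma mink_sym: "mink x y = mink y x"
  by (simp add: mink_def algebra_simps)

lemma mink_nondeg:
  assumes "\<And>v. mink z v = mink z' v" shows "z = z'"
  using assms[of "axis 1 1"] assms[of "axis 2 1"] assms[of "axis 3 1"]
  by (simp add: mink_def axis_def vec_eq_iff forall_3)

lemma mcross_eq:
  "x \<boxtimes> y = vector [- (x$2 * y$3 - x$3 * y$2), x$3 * y$1 - x$1 * y$3, x$1 * y$2 - x$2 * y$1]"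
  (is "_ = ?z")
  unfolding mcross_def
proof (rule the_equality)
  show 1: "\<forall>v. mink ?z v = det (vector [x, y, v] :: real ^ 3 ^ 3)"
    by (simp add: mink_def det_3 algebra_simps)
  show "z = ?z" if "\<forall>v. mink z v = det (vector [x, y, v] :: real ^ 3 ^ 3)" for z
    using that 1 by (intro mink_nondeg) simp
qed

lemma mink_mcross: "mink (x \<boxtimes> y) v = det (vector [x, y, v] :: real ^ 3 ^ 3)"
  by (simp add: mcross_eq mink_def det_3 algebra_simps)

lemma mink_tspace_nonneg:
  assumes "p \<in> hyp2" "w \<in> tspace p"
  shows "(w $ 1)\<^sup>2 \<le> mink w w * ((p $ 1)\<^sup>2 - 1)" "0 \<le> mink w w"
proof -
  define p0 p1 p2 w0 w1 w2 where "p0 = p $ 1" "p1 = p $ 2" "p2 = p $ 3" "w0 = w $ 1" "w1 = w $ 2" "w2 = w $ 3"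
  note d = this
  have p: "p1\<^sup>2 + p2\<^sup>2 = p0\<^sup>2 - 1" "p0 > 0" and w: "p0 * w0 = p1 * w1 + p2 * w2"
    using assms by (auto simp: hyp2_def tspace_def mink_def d power2_eq_square)
  have "(p1 * w1 + p2 * w2)\<^sup>2 + (p1 * w2 - p2 * w1)\<^sup>2 = (p1\<^sup>2 + p2\<^sup>2) * (w1\<^sup>2 + w2\<^sup>2)"
    by (simp add: power2_eq_square algebra_simps)
  then have "(p0 * w0)\<^sup>2 + (p1 * w2 - p2 * w1)\<^sup>2 = (p0\<^sup>2 - 1) * (w1\<^sup>2 + w2\<^sup>2)"
    by (simp only: p w)
  then have "(p0 * w0)\<^sup>2 \<le> (p0\<^sup>2 - 1) * (w1\<^sup>2 + w2\<^sup>2)"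
    using zero_le_power2[of "p1 * w2 - p2 * w1"] by linarith
  then have le: "w0\<^sup>2 \<le> (w1\<^sup>2 + w2\<^sup>2 - w0\<^sup>2) * (p0\<^sup>2 - 1)"
    by (simp add: power2_eq_square algebra_simps)
  then show "(w $ 1)\<^sup>2 \<le> mink w w * ((p $ 1)\<^sup>2 - 1)"
    by (simp add: mink_def d power2_eq_square algebra_simps)
  show "0 \<le> mink w w"
  proof (rule ccontr)
    assume "\<not> ?thesis"
    then have neg: "w1\<^sup>2 + w2\<^sup>2 - w0\<^sup>2 < 0"
      by (simp add: mink_def d power2_eq_square)
    moreover have "p0\<^sup>2 - 1 \<ge> 0" using p(1) by (metis sum_power2_ge_zero)
    ultimately have "(w1\<^sup>2 + w2\<^sup>2 - w0\<^sup>2) * (p0\<^sup>2 - 1) \<le> 0"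
      by (simp add: mult_nonpos_nonneg)
    then have "w0\<^sup>2 \<le> 0" using le by linarith
    then have "w0 = 0" by simp
    then show False using neg sum_power2_ge_zero[of w1 w2] by simp
  qed
qed

lemma Ck_on_hyperbolic:
  "Ck_on n UNIV (\<lambda>t::real. cosh (k * t) *\<^sub>R a + sinh (k * t) *\<^sub>R b + d)"
  for a b d :: "'a::euclidean_space"
proof (induction n arbitrary: a b d)
  case 0
  show ?case by (auto intro!: continuous_intros)
next
  case (Suc n)
  have der: "((\<lambda>t. cosh (k * t) *\<^sub>R a + sinh (k * t) *\<^sub>R b + d) has_derivative
     (\<lambda>h. h *\<^sub>R (cosh (k * x) *\<^sub>R (k *\<^sub>R b) + sinh (k * x) *\<^sub>R (k *\<^sub>R a)))) (at x)" for x
    by (auto intro!: derivative_eq_intros simp: fun_eq_iff algebra_simps)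
  have "frechet_derivative (\<lambda>t. cosh (k * t) *\<^sub>R a + sinh (k * t) *\<^sub>R b + d) (at x) v =
      cosh (k * x) *\<^sub>R (v *\<^sub>R k *\<^sub>R b) + sinh (k * x) *\<^sub>R (v *\<^sub>R k *\<^sub>R a) + 0" for x v
    unfolding frechet_derivative_at[OF der[of x], symmetric] by (simp add: algebra_simps)
  then have "Ck_on n UNIV (\<lambda>x. frechet_derivative
      (\<lambda>t. cosh (k * t) *\<^sub>R a + sinh (k * t) *\<^sub>R b + d) (at x) v)" for v
    by (simp only: Suc.IH)
  then show ?case
    unfolding Ck_on.simps using der differentiableI by blast
qed

lemma smooth_hyperbolic:
  "smooth_map UNIV (\<lambda>t::real. cosh (k * t) *\<^sub>R a + sinh (k * t) *\<^sub>R b + d)"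
  unfolding smooth_map_def using Ck_on_hyperbolic open_UNIV by blast

lemma hyperbolic_has_vector_derivative:
  "((\<lambda>t. cosh (k * t) *\<^sub>R a + sinh (k * t) *\<^sub>R b + d) has_vector_derivative
     cosh (k * x) *\<^sub>R (k *\<^sub>R b) + sinh (k * x) *\<^sub>R (k *\<^sub>R a)) (at x)"
  unfolding has_vector_derivative_def
  by (auto intro!: derivative_eq_intros simp: fun_eq_iff algebra_simps)

lemma ex_geodesic_parallel:
  assumes p: "p \<in> hyp2" and w: "w \<in> tspace p" and v: "v \<in> tspace p"
  obtains c W where "geodesic c" "c 0 = p" "(c has_vector_derivative w) (at 0)"
    "parallel_along c W" "W 0 = v"
proof -
  define k where "k = sqrt (mink w w)"
  define a where "a = mink v w / (k * k)"
  define c where "c = (\<lambda>t::real. cosh (k * t) *\<^sub>R p + sinh (k * t) *\<^sub>R ((1 / k) *\<^sub>R w) + 0)"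
  define c' where "c' = (\<lambda>t::real. cosh (k * t) *\<^sub>R w + sinh (k * t) *\<^sub>R (k *\<^sub>R p) + 0)"
  define W where "W = (\<lambda>t::real. cosh (k * t) *\<^sub>R (a *\<^sub>R w) + sinh (k * t) *\<^sub>R ((a * k) *\<^sub>R p) + (v - a *\<^sub>R w))"
  note nn = mink_tspace_nonneg[OF p w]
  have kk: "k * k = mink w w" "0 \<le> k"
    using nn by (simp_all add: k_def)
  have pp: "mink p p = - 1" "p $ 1 > 0" and pw: "mink p w = 0" "mink w p = 0"
    and pv: "mink p v = 0" "mink v p = 0"
    using p w v by (auto simp: hyp2_def tspace_def mink_sym)
  have k0: "w = 0" if "k = 0"
  proof -
    have "mink w w = 0" "w $ 1 = 0" using that kk(1) nn by auto
    then show ?thesis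
      by (auto simp: mink_def vec_eq_iff forall_3 sum_squares_eq_zero_iff)
  qed
  have kw: "k *\<^sub>R ((1 / k) *\<^sub>R w) = w"
    using k0 by (cases "k = 0") auto
  have c_der: "(c has_vector_derivative c' t) (at t)" for t
    using hyperbolic_has_vector_derivative[of k p "(1 / k) *\<^sub>R w" 0 t]
    by (simp only: c_def c'_def kw add_0_right)
  have c'_der: "(c' has_vector_derivative (k * k) *\<^sub>R c t) (at t)" for t
  proof -
    have "(c' has_vector_derivative cosh (k * t) *\<^sub>R k *\<^sub>R k *\<^sub>R p + sinh (k * t) *\<^sub>R k *\<^sub>R w) (at t)"
      unfolding c'_def by (rule hyperbolic_has_vector_derivative)
    also have "cosh (k * t) *\<^sub>R k *\<^sub>R k *\<^sub>R p + sinh (k * t) *\<^sub>R k *\<^sub>R w = (k * k) *\<^sub>R c t"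
      using k0 by (cases "k = 0") (simp_all add: c_def algebra_simps)
    finally show ?thesis .
  qed
  have W_eq: "W t = a *\<^sub>R c' t + (v - a *\<^sub>R w)" for t
    by (simp add: W_def c'_def algebra_simps)
  have W_der: "(W has_vector_derivative (a * (k * k)) *\<^sub>R c t) (at t)" for t
  proof -
    have "((\<lambda>t. a *\<^sub>R c' t + (v - a *\<^sub>R w)) has_vector_derivative a *\<^sub>R ((k * k) *\<^sub>R c t) + 0) (at t)"
      by (intro has_vector_derivative_add has_vector_derivative_const
          bounded_linear.has_vector_derivative[OF bounded_linear_scaleR_right] c'_der)
    then show ?thesis by (simp add: W_eq[abs_def] algebra_simps)
  qed
  have sinh_k: "sinh (k * t) * sinh (k * t) = cosh (k * t) * cosh (k * t) - 1" for t
    using cosh_square_eq[of "k * t"] by (simp add: power2_eq_square)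
  have mcc: "mink (c t) (c t) = - 1" for t
  proof (cases "k = 0")
    case True then show ?thesis by (simp add: c_def pp)
  next
    case False
    have "mink (c t) (c t) = - (cosh (k * t) * cosh (k * t)) + sinh (k * t) * sinh (k * t) * (mink w w / (k * k))"
      by (simp add: c_def mink_simps pp pw)
    then show ?thesis
      using False by (simp add: sinh_k flip: kk(1))
  qed
  have c_hyp: "c t \<in> hyp2" for t
  proof -
    have "\<bar>w $ 1\<bar> \<le> k * p $ 1"
    proof (rule power2_le_imp_le)
      have "(w $ 1)\<^sup>2 \<le> mink w w * (p $ 1)\<^sup>2"
        using nn by (simp add: algebra_simps)
      then show "\<bar>w $ 1\<bar>\<^sup>2 \<le> (k * p $ 1)\<^sup>2"
        by (simp add: kk(1)[symmetric] power2_eq_square mult.assoc mult.left_commute)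
    qed (use kk pp in simp)
    then have 1: "\<bar>w $ 1 / k\<bar> \<le> p $ 1"
      using kk(2) pp(2) by (cases "k = 0") (auto simp: field_simps abs_div)
    have 2: "\<bar>sinh (k * t)\<bar> < cosh (k * t)"
      by (rule power2_less_imp_less) (simp_all add: cosh_square_eq)
    have "\<bar>sinh (k * t) * (w $ 1 / k)\<bar> \<le> \<bar>sinh (k * t)\<bar> * p $ 1"
      unfolding abs_mult using 1 by (intro mult_left_mono) auto
    also have "\<dots> < cosh (k * t) * p $ 1"
      using 2 pp(2) by simp
    finally have "cosh (k * t) * p $ 1 + sinh (k * t) * (w $ 1 / k) > 0"
      by linarith
    then have "c t $ 1 > 0"
      by (simp add: c_def)
    then show ?thesis using mcc by (simp add: hyp2_def)
  qed
  have tang_c: "tang (c t) (b *\<^sub>R c t) = 0" for b t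
    by (simp add: tang_def mink_simps mcc)
  have c_eq: "c 0 = p" "c' 0 = w" "W 0 = v"
    by (simp_all add: c_def c'_def W_def)
  have mcc': "mink (c t) (c' t) = 0" for t
  proof (cases "k = 0")
    case True then show ?thesis using k0 by (simp add: c'_def mink_simps)
  next
    case False then show ?thesis
      by (simp add: c_def c'_def mink_simps pp pw flip: kk(1))
  qed
  have geo: "geodesic c"
  proof -
    have "vector_derivative c (at s) = c' s" for s
      using c_der by (rule vector_derivative_at)
    moreover have "vector_derivative c' (at t) = (k * k) *\<^sub>R c t" for t
      using c'_der by (rule vector_derivative_at)
    moreover have "smooth_map UNIV c"
      unfolding c_def by (rule smooth_hyperbolic)
    ultimately show ?thesis
      using c_hyp by (auto simp: geodesic_def cov_deriv_def tang_c)
  qed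
  have "parallel_along c W"
  proof -
    have "mink w (v - a *\<^sub>R w) = 0"
      using k0 by (cases "k = 0") (auto simp: mink_simps a_def mink_sym[of v] simp flip: kk(1))
    then have "mink (c t) (v - a *\<^sub>R w) = 0" for t
      by (simp add: c_def mink.add_left mink.scaleR_left) (simp add: mink_simps pv pw)
    then have "W t \<in> tspace (c t)" for t
      by (simp add: tspace_def W_eq mink.add_right mink.scaleR_right mcc')
    moreover have "vector_derivative W (at t) = (a * (k * k)) *\<^sub>R c t" for t
      using W_der by (rule vector_derivative_at)
    moreover have "smooth_map UNIV W"
      unfolding W_def by (rule smooth_hyperbolic)
    ultimately show ?thesis
      by (auto simp: parallel_along_def cov_deriv_def tang_c)
  qed
  then show thesis
    using that geo c_eq c_der[of 0] by simp
qed

lemma tspace_eq_velocities: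
  assumes "p \<in> hyp2"
  shows "tspace p = {w. \<exists>c. range c \<subseteq> hyp2 \<and> c 0 = p \<and> (c has_vector_derivative w) (at 0)}"
proof (intro equalityI subsetI)
  fix w assume w: "w \<in> tspace p"
  obtain c where "geodesic c" "c 0 = p" "(c has_vector_derivative w) (at 0)"
    by (rule ex_geodesic_parallel[OF assms w w])
  then show "w \<in> {w. \<exists>c. range c \<subseteq> hyp2 \<and> c 0 = p \<and> (c has_vector_derivative w) (at 0)}"
    unfolding geodesic_def by blast
next
  fix w assume "w \<in> {w. \<exists>c. range c \<subseteq> hyp2 \<and> c 0 = p \<and> (c has_vector_derivative w) (at 0)}"
  then obtain c where c: "range c \<subseteq> hyp2" "c 0 = p" "(c has_vector_derivative w) (at 0)"
    by blast
  have "((\<lambda>t. mink (c t) (c t)) has_vector_derivative mink (c 0) w + mink w (c 0)) (at 0)"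
    by (rule mink.has_vector_derivative[OF c(3) c(3)])
  moreover have "(\<lambda>t. mink (c t) (c t)) = (\<lambda>t. - 1)"
    using c(1) by (auto simp: hyp2_def)
  ultimately have "mink (c 0) w + mink w (c 0) = 0"
    by (metis vector_derivative_at has_vector_derivative_const)
  then have "mink p w + mink w p = 0" by (simp only: c(2))
  then show "w \<in> tspace p" by (simp add: tspace_def mink_sym[of w])
qed

lemma smooth_map_UNIV_differentiable:
  assumes "smooth_map UNIV f" shows "f differentiable at x"
proof -
  obtain U F where F: "open U" "x \<in> U" "\<And>k. Ck_on k U F" "\<And>y. y \<in> U \<Longrightarrow> F y = f y"
    using assms unfolding smooth_map_def by (metis IntI UNIV_I)
  have "F differentiable at x"
    using F(2) F(3)[of "Suc 0"] by simp
  then show ?thesis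
    using F unfolding differentiable_def by (metis has_derivative_transform_within_open)
qed

lemma hlift_eq:
  assumes p: "x \<in> hyp2" and v: "v \<in> tspace x" and w: "w \<in> tspace x"
  shows "hlift x v w = (w, mink v w *\<^sub>R x)"
proof -
  have *: "vector_derivative (\<lambda>t. (c t, W t)) (at 0) = (w, mink v w *\<^sub>R x)"
    if c: "geodesic c" "c 0 = x" "vector_derivative c (at 0) = w"
      and W: "parallel_along c W" "W 0 = v" for c W
  proof -
    have dc: "(c has_vector_derivative w) (at 0)"
      using c smooth_map_UNIV_differentiable[of c 0]
      by (auto simp: geodesic_def vector_derivative_works)
    define W' where "W' = vector_derivative W (at 0)"
    have dW: "(W has_vector_derivative W') (at 0)"
      using W smooth_map_UNIV_differentiable[of W 0]
      by (auto simp: parallel_along_def vector_derivative_works W'_def)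
    have "((\<lambda>t. mink (c t) (W t)) has_vector_derivative mink (c 0) W' + mink w (W 0)) (at 0)"
      using mink.has_vector_derivative[OF dc dW] .
    moreover have "(\<lambda>t. mink (c t) (W t)) = (\<lambda>t. 0)"
      using W by (auto simp: parallel_along_def tspace_def)
    ultimately have "mink x W' + mink w v = 0"
      using vector_derivative_at by (fastforce simp: c W)
    moreover have "tang x W' = 0"
      using W c by (auto simp: parallel_along_def cov_deriv_def W'_def)
    ultimately have "W' = - (mink x W' *\<^sub>R x)" "mink x W' = - mink w v"
      by (auto simp: tang_def eq_neg_iff_add_eq_0 add.commute)
    then have "W' = mink v w *\<^sub>R x"
      by (metis add.inverse_inverse mink_sym scaleR_minus_left)
    with dc dW show ?thesis
      by (intro vector_derivative_at has_vector_derivative_Pair) auto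
  qed
  obtain c W where "geodesic c" "c 0 = x" "vector_derivative c (at 0) = w"
    "parallel_along c W" "W 0 = v"
    using ex_geodesic_parallel[OF p w v] by (metis vector_derivative_at)
  with *[of c W] show ?thesis
    unfolding hlift_def by (intro the_equality exI[of _ c] exI[of _ W]) (auto dest: *)
qed

lemma vlift_eq: "vlift x v w = (0, w)"
proof -
  have "((\<lambda>t. (x, v + t *\<^sub>R w)) has_vector_derivative (0, 0 + 1 *\<^sub>R w)) (at 0)"
    by (auto intro!: derivative_eq_intros)
  then show ?thesis
    unfolding vlift_def by (simp add: vector_derivative_at)
qed

lemma inj_tb_iso:
  assumes "x \<in> hyp2" "v \<in> tspace x"
  shows "inj_on (tb_iso x v) (tspace x \<times> tspace x)"
  using assms by (auto simp: inj_on_def tb_iso_def hlift_eq vlift_eq)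

lemma frechet_derivative_hyp2:
  assumes D: "(f has_derivative D) (at p within hyp2)" and p: "p \<in> hyp2" and w: "w \<in> tspace p"
  shows "dhyp f p w = D w"
proof -
  obtain c where c: "geodesic c" "c 0 = p" "(c has_vector_derivative w) (at 0)"
    using ex_geodesic_parallel[OF p w w] by blast
  have *: "((\<lambda>t. f (c t)) has_vector_derivative E w) (at 0)"
    if E: "(f has_derivative E) (at p within hyp2)" for E
  proof -
    have "(f has_derivative E) (at (c 0) within range c)"
      using E c by (auto simp: geodesic_def intro: has_derivative_subset)
    then have "(f \<circ> c has_derivative E \<circ> (\<lambda>t. t *\<^sub>R w)) (at 0)"
      using c(3) unfolding has_vector_derivative_def by (rule diff_chain_within[rotated])
    moreover have "E \<circ> (\<lambda>t. t *\<^sub>R w) = (\<lambda>t. t *\<^sub>R E w)"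
      using has_derivative_bounded_linear[OF E] by (auto simp: bounded_linear.linear linear_cmul)
    ultimately show ?thesis
      by (simp add: has_vector_derivative_def o_def)
  qed
  have "(f has_derivative frechet_derivative f (at p within hyp2)) (at p within hyp2)"
    using D frechet_derivative_works by (auto simp: differentiable_def)
  from *[OF this] *[OF D] show ?thesis
    unfolding dhyp_def by (metis vector_derivative_at)
qed

lemma dhyp_mink:
  assumes p: "p \<in> hyp2" "w \<in> tspace p"
    and "X differentiable at p within hyp2" "Y differentiable at p within hyp2"
  shows "dhyp (\<lambda>q. mink (X q) (Y q)) p w = mink (dhyp X p w) (Y p) + mink (X p) (dhyp Y p w)"
proof -
  have "((\<lambda>q. mink (X q) (Y q)) has_derivative (\<lambda>h. mink (X p) (dhyp Y p h) + mink (dhyp X p h) (Y p)))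
      (at p within hyp2)"
    using assms(3,4) unfolding frechet_derivative_works dhyp_def by (rule mink.FDERIV)
  from frechet_derivative_hyp2[OF this p] show ?thesis by simp
qed

lemma lc_conn_tspace: "p \<in> hyp2 \<Longrightarrow> lc_conn V p w \<in> tspace p"
  by (simp add: lc_conn_def tang_def tspace_def hyp2_def mink_simps)

lemma linear_lc_conn:
  assumes "V differentiable at p within hyp2"
  shows "linear (lc_conn V p)"
proof -
  have "linear (dhyp V p)"
    using assms unfolding dhyp_def by (rule linear_frechet_derivative)
  then show ?thesis
    by (auto intro!: linearI simp: lc_conn_def tang_def linear_add linear_cmul mink_simps algebra_simps)
qed

lemma lc_conn_metric:
  assumes p: "p \<in> hyp2" "w \<in> tspace p"
    and "X differentiable at p within hyp2" "Y differentiable at p within hyp2"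
    and "X p \<in> tspace p" "Y p \<in> tspace p"
  shows "dhyp (\<lambda>q. mink (X q) (Y q)) p w = mink (lc_conn X p w) (Y p) + mink (X p) (lc_conn Y p w)"
  using assms dhyp_mink[OF assms(1-4)]
  by (simp add: lc_conn_def tang_def tspace_def mink_simps mink_sym[of _ p])

lemma mink_dhyp_tangent:
  assumes p: "p \<in> hyp2" "w \<in> tspace p"
    and X: "X differentiable at p within hyp2" "\<And>q. q \<in> hyp2 \<Longrightarrow> X q \<in> tspace q"
  shows "mink p (dhyp X p w) = - mink w (X p)"
proof -
  have id: "((\<lambda>q. q) has_derivative (\<lambda>h. h)) (at p within hyp2)" by (rule has_derivative_ident)
  have "((\<lambda>q. mink q (X q)) has_derivative (\<lambda>h. 0)) (at p within hyp2)"
    by (rule has_derivative_transform[OF p(1) _ has_derivative_const[of 0]])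
       (use X in \<open>simp add: tspace_def\<close>)
  from frechet_derivative_hyp2[OF this p]
  have "dhyp (\<lambda>q. mink q (X q)) p w = 0" .
  moreover have "dhyp (\<lambda>q. q) p w = w"
    by (rule frechet_derivative_hyp2[OF id p])
  moreover have "(\<lambda>q. q) differentiable at p within hyp2"
    using id by (auto simp: differentiable_def)
  ultimately show ?thesis
    using dhyp_mink[OF p _ X(1), of "\<lambda>q. q"] by simp
qed

text \<open>The right-hand side is the Lie bracket of the fields \<open>X\<close> and \<open>Y\<close>.\<close>

lemma lc_conn_torsion_free:
  assumes p: "p \<in> hyp2"
    and X: "X differentiable at p within hyp2" "\<And>q. q \<in> hyp2 \<Longrightarrow> X q \<in> tspace q"
    and Y: "Y differentiable at p within hyp2" "\<And>q. q \<in> hyp2 \<Longrightarrow> Y q \<in> tspace q"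
  shows "lc_conn Y p (X p) - lc_conn X p (Y p) = dhyp Y p (X p) - dhyp X p (Y p)"
  using mink_dhyp_tangent[OF p X(2)[OF p] Y] mink_dhyp_tangent[OF p Y(2)[OF p] X]
  by (simp add: lc_conn_def tang_def mink_sym[of "Y p"])

lemma dhyp_section:
  assumes p: "p \<in> hyp2" "w \<in> tspace p"
    and V: "V differentiable at p within hyp2" "\<And>q. q \<in> hyp2 \<Longrightarrow> V q \<in> tspace q"
  shows "dhyp (\<lambda>q. (q, V q)) p w = tb_iso p (V p) (w, lc_conn V p w)"
proof -
  have "((\<lambda>q. (q, V q)) has_derivative (\<lambda>h. (h, dhyp V p h))) (at p within hyp2)"
    using V(1) unfolding frechet_derivative_works dhyp_def
    by (intro has_derivative_Pair has_derivative_ident)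
  then have "dhyp (\<lambda>q. (q, V q)) p w = (w, dhyp V p w)"
    by (rule frechet_derivative_hyp2[OF _ p])
  then show ?thesis
    using p V mink_dhyp_tangent[OF p V]
    by (simp add: tb_iso_def hlift_eq vlift_eq lc_conn_def tang_def mink_sym[of "V p"])
qed

lemma trace_on_basis:
  fixes A :: "'a::euclidean_space \<Rightarrow> 'a"
  assumes A: "linear A" "A ` T \<subseteq> T" and B: "independent B" "span B = T"
  shows "trace_on T A = (\<Sum>b\<in>B. representation B (A b) b)"
proof -
  define C where "C = (SOME B. independent B \<and> span B = T)"
  have C: "independent C" "span C = T"
    using someI[of "\<lambda>B. independent B \<and> span B = T" B] B by (auto simp: C_def)
  have fin: "finite B" "finite C" using B(1) C(1) by (auto intro: independent_imp_finite)
  have inT: "A b \<in> T" if "b \<in> T" for b using A(2) that by auto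
  have BT: "b \<in> T" if "b \<in> B" for b using that B(2) span_base by blast
  have CT: "b \<in> T" if "b \<in> C" for b using that C(2) span_base by blast
  have BT': "v \<in> span B" and CT': "v \<in> span C" if "v \<in> T" for v
    using that B(2) C(2) by auto
  have expand: "(\<Sum>e\<in>E. representation E v e *\<^sub>R e) = v"
    if "independent E" "span E = T" "finite E" "v \<in> T" for E v
    using that sum_representation_eq[of E v E] by auto
  have "(\<Sum>b\<in>B. representation B (A b) b) = (\<Sum>b\<in>B. \<Sum>c\<in>C. representation C b c * representation B (A c) b)"
  proof (rule sum.cong[OF refl])
    fix b assume b: "b \<in> B"
    have "A b = (\<Sum>c\<in>C. representation C b c *\<^sub>R A c)"
      by (subst expand[OF C fin(2) BT[OF b], symmetric])
         (simp add: linear_sum[OF A(1)] linear_cmul[OF A(1)])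
    then show "representation B (A b) b = (\<Sum>c\<in>C. representation C b c * representation B (A c) b)"
      by (simp add: representation_sum[OF B(1)] representation_scale[OF B(1)] span_scale BT' inT CT)
  qed
  also have "\<dots> = (\<Sum>c\<in>C. \<Sum>b\<in>B. representation B (A c) b * representation C b c)"
    by (subst sum.swap) (simp add: mult.commute)
  also have "\<dots> = (\<Sum>c\<in>C. representation C (A c) c)"
  proof (rule sum.cong[OF refl])
    fix c assume c: "c \<in> C"
    have "representation C (A c) c = representation C (\<Sum>b\<in>B. representation B (A c) b *\<^sub>R b) c"
      by (subst expand[OF B fin(1) inT[OF CT[OF c]]]) simp
    also have "\<dots> = (\<Sum>b\<in>B. representation B (A c) b * representation C b c)"
      by (simp add: representation_sum[OF C(1)] representation_scale[OF C(1)] span_scale CT' BT)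
    finally show "(\<Sum>b\<in>B. representation B (A c) b * representation C b c) = representation C (A c) c" ..
  qed
  finally show ?thesis
    by (simp add: trace_on_def C_def[symmetric])
qed

lemma ex1_tangent_plane:
  assumes f: "f differentiable at \<eta>0"
  shows "\<exists>!\<sigma>. plane \<sigma> = graph_tangent_plane f \<eta>0"
proof -
  define D where "D = frechet_derivative f (at \<eta>0)"
  have lin: "linear D" using f linear_frechet_derivative by (auto simp: D_def)
  have D: "D h = h $ 1 * D (axis 1 1) + h $ 2 * D (axis 2 1)" for h
  proof -
    have "h = h $ 1 *\<^sub>R axis 1 1 + h $ 2 *\<^sub>R axis 2 1"
      by (simp add: vec_eq_iff forall_2 axis_def)
    from arg_cong[OF this, of D] show ?thesis
      by (simp only: linear_add[OF lin] linear_cmul[OF lin] real_scaleR_def)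
  qed
  show ?thesis
  proof (rule ex_ex1I)
    have "mink (vector [1, \<eta> $ 1, \<eta> $ 2]) (vector [D \<eta>0 - f \<eta>0, D (axis 1 1), D (axis 2 1)]) =
        f \<eta>0 + D (\<eta> - \<eta>0)" for \<eta>
      using D[of \<eta>] by (simp add: mink_def linear_diff[OF lin])
    then have "plane (vector [D \<eta>0 - f \<eta>0, D (axis 1 1), D (axis 2 1)]) = graph_tangent_plane f \<eta>0"
      unfolding plane_def graph_tangent_plane_def D_def[symmetric] by auto
    then show "\<exists>\<sigma>. plane \<sigma> = graph_tangent_plane f \<eta>0" ..
  next
    fix \<sigma> \<tau> assume "plane \<sigma> = graph_tangent_plane f \<eta>0" "plane \<tau> = graph_tangent_plane f \<eta>0"
    then have "plane \<sigma> = plane \<tau>" by simp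
    then have eq: "mink (vector [1, \<eta> $ 1, \<eta> $ 2]) \<sigma> = mink (vector [1, \<eta> $ 1, \<eta> $ 2]) \<tau>"
      if "norm \<eta> < 1" for \<eta> :: "real ^ 2"
      using that by (auto simp: plane_def set_eq_iff)
    show "\<sigma> = \<tau>"
      using eq[of 0] eq[of "vector [1/2, 0]"] eq[of "vector [0, 1/2]"]
      by (simp add: mink_def vec_eq_iff forall_3 norm_vec_def L2_set_def sum_2)
  qed
qed

lemma bij_betw_klein_proj: "bij_betw klein_proj hyp2 (ball 0 1)"
proof (rule bij_betwI)
  let ?g = "\<lambda>\<eta>::real ^ 2. (1 / sqrt (1 - (norm \<eta>)\<^sup>2)) *\<^sub>R (vector [1, \<eta> $ 1, \<eta> $ 2] :: real ^ 3)"
  have n: "(norm \<eta>)\<^sup>2 = (\<eta> $ 1)\<^sup>2 + (\<eta> $ 2)\<^sup>2" for \<eta> :: "real ^ 2"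
    by (simp add: power2_norm_eq_inner inner_vec_def sum_2) (simp add: power2_eq_square)
  have pos: "1 - (norm \<eta>)\<^sup>2 > 0" if "\<eta> \<in> ball 0 1" for \<eta> :: "real ^ 2"
    using that by (simp add: power_less_one_iff)
  have np: "1 - (norm (klein_proj x))\<^sup>2 = (1 / x $ 1)\<^sup>2" if "x \<in> hyp2" for x
    using that unfolding n by (auto simp: klein_proj_def hyp2_def mink_def field_simps power2_eq_square)
  show "klein_proj \<in> hyp2 \<rightarrow> ball 0 1"
  proof
    fix x assume x: "x \<in> hyp2"
    then have "0 < (1 / x $ 1)\<^sup>2" by (simp add: hyp2_def)
    then have "(norm (klein_proj x))\<^sup>2 < 1\<^sup>2"
      unfolding np[OF x, symmetric] by simp
    then show "klein_proj x \<in> ball 0 1"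
      using power2_less_imp_less by fastforce
  qed
  show "?g \<in> ball 0 1 \<rightarrow> hyp2"
  proof
    fix \<eta> :: "real ^ 2" assume "\<eta> \<in> ball 0 1"
    then have pos': "1 - (norm \<eta>)\<^sup>2 > 0" by (rule pos)
    define s where "s = sqrt (1 - (norm \<eta>)\<^sup>2)"
    have s: "s > 0" "s * s = 1 - (\<eta> $ 1 * \<eta> $ 1 + \<eta> $ 2 * \<eta> $ 2)"
      using pos' by (simp_all add: s_def) (simp add: n power2_eq_square[symmetric])
    have "mink (?g \<eta>) (?g \<eta>) = (1 / s) * (1 / s) * (- (s * s))"
      unfolding s_def[symmetric] mink.scaleR_left mink.scaleR_right s(2) by (simp add: mink_def)
    then show "?g \<eta> \<in> hyp2"
      using s(1) by (simp add: hyp2_def s_def[symmetric])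
  qed
  show "?g (klein_proj x) = x" if "x \<in> hyp2" for x
    using that unfolding np[OF that]
    by (auto simp: klein_proj_def hyp2_def real_sqrt_divide vec_eq_iff forall_3)
  show "klein_proj (?g \<eta>) = \<eta>" if "\<eta> \<in> ball 0 1" for \<eta>
    using pos[OF that] by (auto simp: klein_proj_def vec_eq_iff forall_2)
qed

end

theory Submission
  imports Defs
begin

text \<open>
  Write \<open>J\<close> for \<open>cpx p\<close> and let \<open>A\<close> be the endomorphism \<open>lc_conn V p\<close> of the tangent plane.

  Being Lagrangian and being divergence-free are the same condition pointwise. The section
  \<open>q \<mapsto> (q, V q)\<close> maps a tangent vector \<open>w\<close> to the pair \<open>(w, A w)\<close> of horizontal and vertical parts, so
  the pullback of \<open>\<Omega>\<close> is the alternating form \<open>g(J w1, A w2) - g(A w1, J w2)\<close>. An alternating form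
  on a plane is a multiple of the area form \<open>g(J w1, w2)\<close>, and evaluating it on a frame \<open>e, J e\<close>
  shows that the factor is the trace of \<open>A\<close> (lemma \<open>pullback_Omega_eq_divergence\<close>).

  The fields that come from surfaces are those whose flux form has a potential. Let \<open>\<alpha>\<close> be the
  1-form \<open>\<alpha>(w) = g(V, J w)\<close>. The plane \<open>P\<^sub>\<sigma>\<close> osculates the graph of \<open>klein_fun u\<close> to first order.
  On the hyperboloid, where Klein heights are multiplied by \<open>x\<^sub>0\<close>, this says that the
  restriction of the linear function \<open>mink _ \<sigma>\<close> osculates \<open>u\<close> to first order at \<open>p\<close>, so
  \<open>du(w) = mink \<sigma> w = g(p \<boxtimes> \<sigma>, J w)\<close> for tangent \<open>w\<close>. As \<open>J\<close> is an isometry of the tangent plane and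
  \<open>g\<close> is nondegenerate there, \<open>V p = p \<boxtimes> \<sigma>\<close> is equivalent to \<open>du = \<alpha>\<close> at \<open>p\<close>
  (lemma \<open>assoc_field_iff_potential\<close>).

  It remains to see that \<open>\<alpha>\<close> is exact precisely when \<open>V\<close> is Lagrangian. The hyperboloid is a graph
  over the plane of the last two coordinates; in this global chart the exterior derivative of \<open>\<alpha>\<close>
  is minus the pullback of \<open>\<Omega>\<close> (lemma \<open>flux_derivative_skew\<close>). An exact form is closed because
  second derivatives are symmetric, and on the plane a closed form is exact by the Poincare lemma;
  the potential is smooth because its first derivatives are.
\<close>

section \<open>Calculus of \<open>C\<^sup>k\<close> maps on open sets\<close>

lemma Ck_on_cong:
  assumes "open U" "\<And>x. x \<in> U \<Longrightarrow> f x = g x" "Ck_on k U f"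
  shows "Ck_on k U g"
  using assms(2,3)
proof (induction k arbitrary: f g)
  case 0
  then show ?case by (simp cong: continuous_on_cong)
next
  case (Suc k)
  have d: "(g has_derivative frechet_derivative f (at x)) (at x)" if "x \<in> U" for x
  proof (rule has_derivative_transform_within_open[OF _ assms(1) that Suc.prems(1)])
    show "(f has_derivative frechet_derivative f (at x)) (at x)"
      unfolding frechet_derivative_works[symmetric] using Suc.prems(2) that by simp
  qed
  have "Ck_on k U (\<lambda>x. frechet_derivative g (at x) v)" for v
  proof (rule Suc.IH)
    show "Ck_on k U (\<lambda>x. frechet_derivative f (at x) v)"
      using Suc.prems(2) by simp
    show "frechet_derivative f (at x) v = frechet_derivative g (at x) v" if "x \<in> U" for x
      using frechet_derivative_at[OF d[OF that]] by simp
  qed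
  then show ?case
    unfolding Ck_on.simps(2) differentiable_def using d by blast
qed

lemma Ck_on_local:
  assumes "\<And>x. x \<in> U \<Longrightarrow> \<exists>W. open W \<and> x \<in> W \<and> Ck_on k W f"
  shows "Ck_on k U f"
  using assms
proof (induction k arbitrary: f)
  case 0
  then show ?case
    by (metis Ck_on.simps(1) continuous_at_imp_continuous_on continuous_on_eq_continuous_at)
next
  case (Suc k)
  from Suc.prems show ?case
    unfolding Ck_on.simps by (meson Suc.IH)
qed

lemma Ck_on_SucI:
  assumes "open U" "\<And>x. x \<in> U \<Longrightarrow> (f has_derivative D x) (at x)"
    and "\<And>v. Ck_on k U (\<lambda>x. D x v)"
  shows "Ck_on (Suc k) U f"
proof -
  have "Ck_on k U (\<lambda>x. frechet_derivative f (at x) v)" for v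
    by (rule Ck_on_cong[OF assms(1) _ assms(3)[of v]]) (simp add: frechet_derivative_at[OF assms(2)])
  then show ?thesis
    unfolding Ck_on.simps(2) differentiable_def using assms(2) by blast
qed

lemma Ck_on_Suc_imp_Ck_on: "Ck_on (Suc k) U f \<Longrightarrow> Ck_on k U f"
proof (induction k arbitrary: f)
  case 0
  then have "\<forall>x\<in>U. isCont f x"
    unfolding Ck_on.simps(2) by (blast intro: differentiable_imp_continuous_within)
  then show ?case
    by (simp add: continuous_at_imp_continuous_on)
next
  case (Suc k)
  note prems = Ck_on.simps(2)[THEN iffD1, OF Suc.prems]
  show ?case
    unfolding Ck_on.simps(2)[of k] using prems Suc.IH by blast
qed

lemma Ck_on_Suc_has_derivative:
  "Ck_on (Suc k) U f \<Longrightarrow> x \<in> U \<Longrightarrow> (f has_derivative frechet_derivative f (at x)) (at x)"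
  unfolding frechet_derivative_works[symmetric] by simp

lemma Ck_on_const: "open U \<Longrightarrow> Ck_on k U (\<lambda>x. c)"
proof (induction k arbitrary: c)
  case (Suc k)
  then show ?case by (intro Ck_on_SucI[where D = "\<lambda>x h. 0"]) auto
qed simp

lemma Ck_on_bounded_linear:
  assumes "open U" "bounded_linear f" shows "Ck_on k U f"
proof (cases k)
  case 0
  then show ?thesis using assms by (simp add: linear_continuous_on)
next
  case (Suc n)
  show ?thesis
    unfolding Suc using assms
    by (intro Ck_on_SucI[where D = "\<lambda>x. f"] bounded_linear_imp_has_derivative Ck_on_const)
qed

lemma Ck_on_add:
  assumes "open U" "Ck_on k U f" "Ck_on k U g"
  shows "Ck_on k U (\<lambda>x. f x + g x)"
  using assms(2,3)
proof (induction k arbitrary: f g)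
  case 0
  then show ?case by (auto intro: continuous_intros)
next
  case (Suc k)
  show ?case
  proof (rule Ck_on_SucI[OF assms(1)])
    show "((\<lambda>x. f x + g x) has_derivative
        (\<lambda>h. frechet_derivative f (at x) h + frechet_derivative g (at x) h)) (at x)" if "x \<in> U" for x
      using Suc.prems that by (intro has_derivative_add Ck_on_Suc_has_derivative)
    show "Ck_on k U (\<lambda>x. frechet_derivative f (at x) v + frechet_derivative g (at x) v)" for v
      using Suc.prems by (intro Suc.IH) auto
  qed
qed

lemma Ck_on_sum:
  assumes "open U" "\<And>i. i \<in> I \<Longrightarrow> Ck_on k U (f i)"
  shows "Ck_on k U (\<lambda>x. \<Sum>i\<in>I. f i x)"
  using assms(2)
  by (induction I rule: infinite_finite_induct) (auto intro: Ck_on_const Ck_on_add assms(1))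

lemma Ck_on_bilinear:
  fixes f :: "'d::euclidean_space \<Rightarrow> 'a::euclidean_space" and g :: "'d \<Rightarrow> 'b::euclidean_space"
    and p :: "'a \<Rightarrow> 'b \<Rightarrow> 'c::euclidean_space"
  assumes p: "bounded_bilinear p" and U: "open U" and "Ck_on k U f" "Ck_on k U g"
  shows "Ck_on k U (\<lambda>x. p (f x) (g x))"
  using assms(3,4)
proof (induction k arbitrary: f g)
  case 0
  then show ?case by (auto intro: bounded_bilinear.continuous_on[OF p])
next
  case (Suc k)
  show ?case
  proof (rule Ck_on_SucI[OF U])
    show "((\<lambda>x. p (f x) (g x)) has_derivative
        (\<lambda>h. p (f x) (frechet_derivative g (at x) h) + p (frechet_derivative f (at x) h) (g x))) (at x)"
      if "x \<in> U" for x
      using Suc.prems that by (intro bounded_bilinear.FDERIV[OF p] Ck_on_Suc_has_derivative)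
    show "Ck_on k U (\<lambda>x. p (f x) (frechet_derivative g (at x) v) + p (frechet_derivative f (at x) v) (g x))" for v
      using Suc.prems Suc.prems[THEN Ck_on_Suc_imp_Ck_on] by (intro Ck_on_add U Suc.IH) auto
  qed
qed

text \<open>
  By the chain rule, the derivative of \<open>g \<circ> f\<close> in a direction \<open>v\<close> is
  \<open>\<Sum>b. (Df(x) v \<bullet> b) \<cdot> Dg(f x) b\<close>, a sum of products in which the second factors are again
  compositions with \<open>f\<close>, of one order of differentiability less. Expanding over the basis is needed
  because \<open>Ck_on\<close> speaks only of derivatives in constant directions.
\<close>

lemma Ck_on_compose:
  fixes f :: "'a::euclidean_space \<Rightarrow> 'b::euclidean_space" and g :: "'b \<Rightarrow> 'c::euclidean_space"
  assumes U: "open U" and fU: "f ` U \<subseteq> W" and "Ck_on k U f" "Ck_on k W g"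
  shows "Ck_on k U (\<lambda>x. g (f x))"
  using assms(3,4)
proof (induction k arbitrary: g)
  case 0
  then show ?case
    unfolding Ck_on.simps(1) by (rule continuous_on_compose2[rotated, OF _ fU])
next
  case (Suc k)
  note ck = Ck_on_Suc_imp_Ck_on[OF Suc.prems(1)]
  show ?case
  proof (rule Ck_on_SucI[OF U])
    fix x assume x: "x \<in> U"
    let ?g = "frechet_derivative g (at (f x))" and ?f = "frechet_derivative f (at x)"
    have g: "(g has_derivative ?g) (at (f x))"
      by (rule Ck_on_Suc_has_derivative[OF Suc.prems(2)]) (use x fU in auto)
    have comp: "((\<lambda>x. g (f x)) has_derivative (\<lambda>h. ?g (?f h))) (at x)"
      by (rule has_derivative_compose[of f _ x UNIV g ?g, OF Ck_on_Suc_has_derivative[OF Suc.prems(1) x] g])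
    have exp: "?g w = (\<Sum>b\<in>Basis. (w \<bullet> b) *\<^sub>R ?g b)" for w
    proof -
      have "?g w = ?g (\<Sum>b\<in>Basis. (w \<bullet> b) *\<^sub>R b)"
        by (simp only: euclidean_representation)
      also have "\<dots> = (\<Sum>b\<in>Basis. (w \<bullet> b) *\<^sub>R ?g b)"
        by (simp only: linear_sum[OF has_derivative_linear[OF g]] linear_cmul[OF has_derivative_linear[OF g]])
      finally show ?thesis .
    qed
    have "(\<lambda>h. ?g (?f h)) = (\<lambda>h. \<Sum>b\<in>Basis. (?f h \<bullet> b) *\<^sub>R ?g b)"
      by (rule ext) (rule exp)
    then show "((\<lambda>x. g (f x)) has_derivative (\<lambda>h. \<Sum>b\<in>Basis. (?f h \<bullet> b) *\<^sub>R ?g b)) (at x)"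
      by (rule has_derivative_eq_rhs[OF comp])
  next
    fix v
    have "Ck_on k U (\<lambda>x. frechet_derivative f (at x) v \<bullet> b)" for b
      using Suc.prems(1) by (intro Ck_on_bilinear[OF bounded_bilinear_inner U] Ck_on_const[OF U]) simp
    moreover have "Ck_on k U (\<lambda>x. frechet_derivative g (at (f x)) b)" for b
      using Suc.prems(2) ck by (intro Suc.IH) simp_all
    ultimately show "Ck_on k U (\<lambda>x. \<Sum>b\<in>Basis. (frechet_derivative f (at x) v \<bullet> b) *\<^sub>R frechet_derivative g (at (f x)) b)"
      by (intro Ck_on_sum[OF U] Ck_on_bilinear[OF bounded_bilinear_scaleR U])
  qed
qed

lemma Ck_on_subset: "Ck_on k U f \<Longrightarrow> W \<subseteq> U \<Longrightarrow> Ck_on k W f"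
proof (induction k arbitrary: f)
  case 0
  then show ?case by (simp add: continuous_on_subset)
next
  case (Suc k)
  have "Ck_on k W (\<lambda>x. frechet_derivative f (at x) v)" for v
    using Suc.prems by (intro Suc.IH) simp_all
  with Suc.prems show ?case by auto
qed

lemma smooth_mapE:
  assumes "smooth_map X f" "x \<in> X"
  obtains U F where "open U" "x \<in> U" "\<And>k. Ck_on k U F" "\<And>y. y \<in> X \<inter> U \<Longrightarrow> F y = f y"
proof -
  from assms have "\<exists>U F. open U \<and> x \<in> U \<and> (\<forall>k. Ck_on k U F) \<and> (\<forall>y\<in>X \<inter> U. F y = f y)"
    unfolding smooth_map_def by (rule bspec)
  then obtain U F where "open U \<and> x \<in> U \<and> (\<forall>k. Ck_on k U F) \<and> (\<forall>y\<in>X \<inter> U. F y = f y)"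
    by (elim exE)
  then show thesis
    by (intro that[of U F]) simp_all
qed

text \<open>
  The link between \<open>smooth_map\<close> on a set that is not open and \<open>Ck_on\<close>: after composition with a smooth
  map from an open set into \<open>X\<close>, the local smooth extensions of \<open>f\<close> are only evaluated on \<open>X\<close>, where they
  agree with \<open>f\<close>.
\<close>

lemma smooth_map_compose_Ck_on:
  assumes f: "smooth_map X f" and "open U" "\<And>k. Ck_on k U g" "g ` U \<subseteq> X"
  shows "Ck_on k U (\<lambda>x. f (g x))"
proof (rule Ck_on_local)
  fix x assume x: "x \<in> U"
  then have "g x \<in> X" using assms(4) by blast
  then obtain W F where F: "open W" "g x \<in> W" "\<And>k. Ck_on k W F" "\<And>y. y \<in> X \<inter> W \<Longrightarrow> F y = f y"
    by (rule smooth_mapE[OF f]) (rule that)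
  define N where "N = U \<inter> g -` W"
  have "continuous_on U g"
    using assms(3)[of 0] by (simp only: Ck_on.simps)
  then have N: "open N"
    unfolding N_def using assms(2) F(1) by (rule continuous_open_preimage)
  have NU: "N \<subseteq> U" and gN: "g ` N \<subseteq> W"
    by (auto simp: N_def)
  have "Ck_on k N (\<lambda>x. F (g x))"
    by (rule Ck_on_compose[OF N gN Ck_on_subset[OF assms(3) NU] F(3)])
  then have "Ck_on k N (\<lambda>x. f (g x))"
  proof (rule Ck_on_cong[OF N, rotated])
    fix z assume "z \<in> N"
    then show "F (g z) = f (g z)"
      by (intro F(4)) (use NU gN assms(4) in blast)
  qed
  moreover have "x \<in> N"
    using x F(2) by (simp add: N_def)
  ultimately show "\<exists>W. open W \<and> x \<in> W \<and> Ck_on k W (\<lambda>x. f (g x))"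
    using N by (intro exI[of _ N] conjI)
qed

section \<open>Closed and exact 1-forms on a Euclidean space\<close>

text \<open>
  Symmetry of the second derivative of \<open>u\<close>, whose gradient is \<open>B\<close>, at a point where \<open>B\<close> is
  differentiable. The second difference of \<open>u\<close> along \<open>t h\<close> and \<open>t k\<close> is symmetric in \<open>h\<close> and \<open>k\<close>; by the
  mean value theorem in the direction \<open>h\<close> it equals \<open>t\<^sup>2 (B' k \<bullet> h) + o(t\<^sup>2)\<close>.
\<close>

lemma symmetric_derivative_of_gradient:
  fixes u :: "'a::real_inner \<Rightarrow> real"
  assumes u: "\<And>x. (u has_derivative (\<lambda>h. B x \<bullet> h)) (at x)"
    and B: "(B has_derivative B') (at y)"
  shows "B' h \<bullet> k = B' k \<bullet> h"
proof -
  have *: "\<exists>d>0. \<forall>t. 0 < t \<and> t < d \<longrightarrow>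
      \<bar>u (y + t *\<^sub>R h + t *\<^sub>R k) - u (y + t *\<^sub>R h) - u (y + t *\<^sub>R k) + u y - t\<^sup>2 * (B' k \<bullet> h)\<bar> \<le> 2 * e * (norm h + norm k)\<^sup>2 * t\<^sup>2"
    if e: "e > 0" for e and h k :: 'a
  proof -
    define M where "M = norm h + norm k"
    have M: "M \<ge> 0" by (simp add: M_def)
    interpret B': bounded_linear B' by (rule has_derivative_bounded_linear[OF B])
    obtain d where d: "d > 0" "\<And>x. norm (x - y) < d \<Longrightarrow> norm (B x - B y - B' (x - y)) \<le> e * norm (x - y)"
      using B e unfolding has_derivative_at_alt by blast
    have "\<bar>u (y + t *\<^sub>R h + t *\<^sub>R k) - u (y + t *\<^sub>R h) - u (y + t *\<^sub>R k) + u y - t\<^sup>2 * (B' k \<bullet> h)\<bar> \<le> 2 * e * M\<^sup>2 * t\<^sup>2"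
      if t: "0 < t" "t < d / (M + 1)" for t
    proof -
      have tM: "t * M < d"
        using t M by (simp add: field_simps)
      define g where "g = (\<lambda>s. u (y + s *\<^sub>R h + t *\<^sub>R k) - u (y + s *\<^sub>R h))"
      define g' where "g' = (\<lambda>s. (B (y + s *\<^sub>R h + t *\<^sub>R k) - B (y + s *\<^sub>R h)) \<bullet> h)"
      have "(g has_derivative (\<lambda>r. r * g' s)) (at s)" for s
        unfolding g_def g'_def
        by (auto intro!: derivative_eq_intros has_derivative_compose[OF _ u] simp: algebra_simps)
      then have "(g has_real_derivative g' s) (at s)" for s
        by (simp add: has_field_derivative_def mult_commute_abs)
      then obtain s where s: "0 < s" "s < t" "g t - g 0 = (t - 0) * g' s"
        using MVT2[of 0 t g g'] t by auto
      \<comment> \<open>the error of the linear approximation of \<open>B\<close> at \<open>y\<close>\<close>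
      define R where "R = (\<lambda>x. B (y + x) - B y - B' x)"
      have R: "norm (R x) \<le> e * (t * M)" if "norm x \<le> t * M" for x
        using d(2)[of "y + x"] that tM e by (auto simp: R_def intro: order_trans mult_left_mono)
      have "norm (s *\<^sub>R h) \<le> t * norm h" using s by (simp add: mult_right_mono)
      moreover have "norm (t *\<^sub>R k) \<le> t * norm k" using t by simp
      moreover have "0 \<le> t * norm k" using t by simp
      moreover note norm_triangle_ineq[of "s *\<^sub>R h" "t *\<^sub>R k"]
      ultimately have n: "norm (s *\<^sub>R h) \<le> t * M" "norm (s *\<^sub>R h + t *\<^sub>R k) \<le> t * M"
        unfolding M_def distrib_left by linarith+
      have "g' s = t * (B' k \<bullet> h) + (R (s *\<^sub>R h + t *\<^sub>R k) - R (s *\<^sub>R h)) \<bullet> h"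
        by (simp add: g'_def R_def B'.add B'.scaleR algebra_simps inner_diff_left inner_add_left)
      then have "\<bar>g' s - t * (B' k \<bullet> h)\<bar> \<le> norm (R (s *\<^sub>R h + t *\<^sub>R k) - R (s *\<^sub>R h)) * norm h"
        using Cauchy_Schwarz_ineq2 by (metis add_diff_cancel_left')
      also have "\<dots> \<le> (2 * e * (t * M)) * M"
        using R[OF n(1)] R[OF n(2)] norm_triangle_ineq4[of "R (s *\<^sub>R h + t *\<^sub>R k)" "R (s *\<^sub>R h)"] e t M
        by (intro mult_mono) (auto simp: M_def)
      finally have "t * \<bar>g' s - t * (B' k \<bullet> h)\<bar> \<le> t * ((2 * e * (t * M)) * M)"
        using t by (intro mult_left_mono) auto
      moreover have "u (y + t *\<^sub>R h + t *\<^sub>R k) - u (y + t *\<^sub>R h) - u (y + t *\<^sub>R k) + u y - t\<^sup>2 * (B' k \<bullet> h)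
          = t * (g' s - t * (B' k \<bullet> h))"
        using s(3) by (simp add: g_def algebra_simps power2_eq_square)
      moreover have "\<bar>t * (g' s - t * (B' k \<bullet> h))\<bar> = t * \<bar>g' s - t * (B' k \<bullet> h)\<bar>"
        using t by (simp add: abs_mult)
      ultimately show ?thesis
        by (simp only:) (simp add: power2_eq_square mult_ac)
    qed
    moreover have "d / (M + 1) > 0" using d M by simp
    ultimately show ?thesis unfolding M_def by blast
  qed
  have "\<bar>B' k \<bullet> h - B' h \<bullet> k\<bar> \<le> 0 + e" if e: "e > 0" for e
  proof -
    define M where "M = norm h + norm k"
    \<comment> \<open>the two second differences contribute \<open>2 * \<epsilon> * M\<^sup>2 * t\<^sup>2\<close> each; the summand 1 covers \<open>M = 0\<close>\<close>
    define \<epsilon> where "\<epsilon> = e / (4 * M\<^sup>2 + 1)"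
    have \<epsilon>: "\<epsilon> > 0" "4 * \<epsilon> * M\<^sup>2 \<le> e"
      using e by (auto simp: \<epsilon>_def field_simps add_pos_nonneg)
    obtain d1 where d1: "d1 > 0" "\<And>t. 0 < t \<Longrightarrow> t < d1 \<Longrightarrow>
        \<bar>u (y + t *\<^sub>R h + t *\<^sub>R k) - u (y + t *\<^sub>R h) - u (y + t *\<^sub>R k) + u y - t\<^sup>2 * (B' k \<bullet> h)\<bar> \<le> 2 * \<epsilon> * M\<^sup>2 * t\<^sup>2"
      using *[OF \<epsilon>(1), of h k] unfolding M_def by blast
    obtain d2 where d2: "d2 > 0" "\<And>t. 0 < t \<Longrightarrow> t < d2 \<Longrightarrow>
        \<bar>u (y + t *\<^sub>R k + t *\<^sub>R h) - u (y + t *\<^sub>R k) - u (y + t *\<^sub>R h) + u y - t\<^sup>2 * (B' h \<bullet> k)\<bar> \<le> 2 * \<epsilon> * M\<^sup>2 * t\<^sup>2"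
      using *[OF \<epsilon>(1), of k h] unfolding add.commute[of "norm k" "norm h"] M_def[symmetric] by blast
    define t where "t = min d1 d2 / 2"
    have t: "0 < t" "t < d1" "t < d2" using d1 d2 by (auto simp: t_def)
    have swap: "y + t *\<^sub>R k + t *\<^sub>R h = y + t *\<^sub>R h + t *\<^sub>R k" by simp
    have "\<bar>t\<^sup>2 * (B' k \<bullet> h) - t\<^sup>2 * (B' h \<bullet> k)\<bar> \<le> 2 * \<epsilon> * M\<^sup>2 * t\<^sup>2 + 2 * \<epsilon> * M\<^sup>2 * t\<^sup>2"
      using d1(2)[OF t(1,2)] d2(2)[OF t(1,3)] unfolding swap by linarith
    then have "t\<^sup>2 * \<bar>B' k \<bullet> h - B' h \<bullet> k\<bar> \<le> t\<^sup>2 * (4 * \<epsilon> * M\<^sup>2)"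
      unfolding right_diff_distrib[symmetric] abs_mult by (simp add: mult_ac)
    then show ?thesis
      using t(1) \<epsilon>(2) by simp
  qed
  then have "\<bar>B' k \<bullet> h - B' h \<bullet> k\<bar> \<le> 0"
    by (rule field_le_epsilon)
  then show ?thesis by simp
qed

text \<open>
  The potential is the integral of the form along the segment from the origin,
  \<open>u(x) = \<integral>\<^sub>0\<^sup>1 B(t x) \<bullet> x dt\<close>. Differentiating under the integral sign in a direction \<open>h\<close> gives the integrand
  \<open>B(t x) \<bullet> h + t (B'(t x) h \<bullet> x)\<close>, which by symmetry of \<open>B'\<close> is the \<open>t\<close>-derivative of
  \<open>t (B(t x) \<bullet> h)\<close>.
\<close>

lemma Poincare_lemma:
  fixes B :: "'a::euclidean_space \<Rightarrow> 'a"
  assumes B: "\<And>x. (B has_derivative B' x) (at x)"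
    and cont: "\<And>v. continuous_on UNIV (\<lambda>x. B' x v)"
    and sym: "\<And>x h k. B' x h \<bullet> k = B' x k \<bullet> h"
  shows "\<exists>u. \<forall>x. (u has_derivative (\<lambda>h. B x \<bullet> h)) (at x)"
proof -
  have contB: "continuous_on A B" for A
    using B by (meson continuous_at_imp_continuous_on has_derivative_continuous)
  define u where "u = (\<lambda>x. integral (cbox 0 1) (\<lambda>t. B (t *\<^sub>R x) \<bullet> x))"
  define D where "D = (\<lambda>x t. Blinfun (\<lambda>h. B (t *\<^sub>R x) \<bullet> h + t * (B' (t *\<^sub>R x) h \<bullet> x)))"
  have bl: "bounded_linear (\<lambda>h. B (t *\<^sub>R x) \<bullet> h + t * (B' (t *\<^sub>R x) h \<bullet> x))" for x t
    by (intro bounded_linear_add bounded_linear_const_mult bounded_linear_inner_right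
        bounded_linear_inner_left_comp has_derivative_bounded_linear[OF B])
  have D: "blinfun_apply (D x t) = (\<lambda>h. B (t *\<^sub>R x) \<bullet> h + t * (B' (t *\<^sub>R x) h \<bullet> x))" for x t
    unfolding D_def by (rule bounded_linear_Blinfun_apply[OF bl])
  have contD: "continuous_on (UNIV \<times> cbox 0 1) (\<lambda>(x, t). D x t)"
    by (rule continuous_on_blinfun_componentwise)
       (auto simp: split_beta D intro!: continuous_intros continuous_on_compose2[OF contB[of UNIV]]
          continuous_on_compose2[OF cont])
  have "(u has_derivative blinfun_apply (integral (cbox 0 1) (D x))) (at x within UNIV)" for x
    unfolding u_def
  proof (rule leibniz_rule[OF _ _ contD])
    show "((\<lambda>x. B (t *\<^sub>R x) \<bullet> x) has_derivative blinfun_apply (D y t)) (at y within UNIV)" for y t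
    proof -
      have "((\<lambda>x. B (t *\<^sub>R x)) has_derivative (\<lambda>h. B' (t *\<^sub>R y) (t *\<^sub>R h))) (at y)"
        by (rule has_derivative_compose[OF _ B]) (auto intro!: derivative_eq_intros)
      from has_derivative_inner[OF this has_derivative_ident]
      show ?thesis
        by (simp add: D linear_cmul[OF has_derivative_linear[OF B]])
    qed
    show "(\<lambda>t. B (t *\<^sub>R x) \<bullet> x) integrable_on cbox 0 1" for x
      by (intro integrable_continuous continuous_intros continuous_on_compose2[OF contB[of UNIV]]) auto
  qed auto
  moreover have "blinfun_apply (integral (cbox 0 1) (D x)) = (\<lambda>h. B x \<bullet> h)" for x
  proof
    fix h
    have "continuous_on (cbox 0 1) (\<lambda>t. case (x, t) of (x, t) \<Rightarrow> D x t)"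
      by (rule continuous_on_compose2[OF contD]) (auto intro!: continuous_intros)
    then have "continuous_on (cbox 0 1) (D x)" by simp
    then have "blinfun_apply (integral (cbox 0 1) (D x)) h = integral (cbox 0 1) (\<lambda>t. blinfun_apply (D x t) h)"
      by (intro integral_linear[OF _ blinfun.bounded_linear_left, unfolded o_def, symmetric] integrable_continuous)
    moreover have "((\<lambda>t. blinfun_apply (D x t) h) has_integral 1 * (B (1 *\<^sub>R x) \<bullet> h) - 0 * (B (0 *\<^sub>R x) \<bullet> h)) {0..1}"
    proof (rule fundamental_theorem_of_calculus)
      fix t :: real
      have "((\<lambda>t. B (t *\<^sub>R x)) has_derivative (\<lambda>r. B' (t *\<^sub>R x) (r *\<^sub>R x))) (at t within {0..1})"
        by (rule has_derivative_compose[OF _ B]) (auto intro!: derivative_eq_intros)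
      from has_derivative_mult[OF has_derivative_ident has_derivative_inner_left[OF this, of h]]
      show "((\<lambda>t. t * (B (t *\<^sub>R x) \<bullet> h)) has_vector_derivative blinfun_apply (D x t) h) (at t within {0..1})"
        by (simp add: has_vector_derivative_def D linear_cmul[OF has_derivative_linear[OF B]] sym[of _ h]
            algebra_simps)
    qed simp
    ultimately show "blinfun_apply (integral (cbox 0 1) (D x)) h = B x \<bullet> h"
      by (simp add: integral_unique)
  qed
  ultimately have "(u has_derivative (\<lambda>h. B x \<bullet> h)) (at x)" for x
    by (simp only:)
  then show ?thesis by blast
qed

section \<open>Algebra of the Minkowski cross product\<close>

lemma bounded_bilinear_mcross: "bounded_bilinear (\<boxtimes>)"
  unfolding bilinear_conv_bounded_bilinear[symmetric] bilinear_def linear_iff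
  by (simp add: mcross_eq vec_eq_iff forall_3 algebra_simps)

interpretation mcross: bounded_bilinear "(\<boxtimes>)"
  by (rule bounded_bilinear_mcross)

lemma mcross_swap: "y \<boxtimes> x = - (x \<boxtimes> y)"
  by (simp add: mcross_eq vec_eq_iff forall_3)

lemma mink_mcross_self: "mink x (x \<boxtimes> y) = 0" "mink y (x \<boxtimes> y) = 0"
  by (simp_all add: mcross_eq mink_def algebra_simps)

lemma mink_mcross_cyclic: "mink x (y \<boxtimes> z) = mink y (z \<boxtimes> x)"
  by (simp add: mcross_eq mink_def algebra_simps)

lemma mcross_mcross: "x \<boxtimes> (y \<boxtimes> z) = mink x y *\<^sub>R z - mink x z *\<^sub>R y"
  by (simp add: mcross_eq mink_def vec_eq_iff forall_3 algebra_simps)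

lemma mink_mcross_mcross:
  "mink (a \<boxtimes> b) (c \<boxtimes> d) = mink a d * mink b c - mink a c * mink b d"
  by (simp add: mcross_eq mink_def algebra_simps)

lemma mink_eq_0_imp_eq_0:
  assumes "p \<in> hyp2" "w \<in> tspace p" "mink w w = 0"
  shows "w = 0"
proof -
  have "w $ 1 = 0"
    using mink_tspace_nonneg(1)[OF assms(1,2)] assms(3) by simp
  then show ?thesis
    using assms(3) by (auto simp: mink_def vec_eq_iff forall_3 sum_squares_eq_zero_iff)
qed

lemma cpx_in_tspace: "p \<boxtimes> v \<in> tspace p"
  by (simp add: tspace_def mink_mcross_self)

lemma cpx_cpx:
  assumes "p \<in> hyp2" "v \<in> tspace p"
  shows "p \<boxtimes> (p \<boxtimes> v) = - v"
  using assms by (simp add: mcross_mcross hyp2_def tspace_def)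

lemma mink_cpx_cpx:
  assumes "p \<in> hyp2" "w \<in> tspace p"
  shows "mink (p \<boxtimes> v) (p \<boxtimes> w) = mink v w"
  using assms by (simp add: mink_mcross_mcross hyp2_def tspace_def)

text \<open>
  The cross product of two vectors of a plane is normal to that plane: \<open>p \<boxtimes> (a \<boxtimes> b)\<close> vanishes by
  \<open>mcross_mcross\<close>, and applying \<open>p \<boxtimes> _\<close> once more recovers \<open>a \<boxtimes> b\<close> up to its component along \<open>p\<close>.
\<close>

lemma mcross_tspace:
  assumes p: "p \<in> hyp2" and a: "a \<in> tspace p" and b: "b \<in> tspace p"
  shows "a \<boxtimes> b = mink (p \<boxtimes> a) b *\<^sub>R - p"
proof -
  have "p \<boxtimes> (a \<boxtimes> b) = 0"
    using a b by (simp add: mcross_mcross tspace_def)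
  then have "p \<boxtimes> (p \<boxtimes> (a \<boxtimes> b)) = 0"
    by (simp add: mcross.zero_right)
  moreover have "mink p p = - 1"
    using p by (simp add: hyp2_def)
  ultimately have "- (a \<boxtimes> b) = mink p (a \<boxtimes> b) *\<^sub>R p"
    by (simp add: mcross_mcross[of p p])
  then have "a \<boxtimes> b = - (mink p (a \<boxtimes> b) *\<^sub>R p)"
    by (metis minus_minus)
  moreover have "mink p (a \<boxtimes> b) = mink (p \<boxtimes> a) b"
    using mink_mcross_cyclic[of b p a] by (simp add: mink_sym[of "p \<boxtimes> a"])
  ultimately show ?thesis by simp
qed

lemma mink_mcross_tspace_eq_0:
  assumes "p \<in> hyp2" "a \<in> tspace p" "b \<in> tspace p" "v \<in> tspace p"
  shows "mink v (a \<boxtimes> b) = 0"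
  using assms by (simp add: mcross_tspace tspace_def mink_simps mink_sym[of v])

text \<open>
  Obtained by evaluating \<open>e \<boxtimes> (e \<boxtimes> v)\<close> in two ways, by \<open>mcross_mcross\<close> and by \<open>mcross_tspace\<close>.
\<close>

lemma tspace_expansion:
  assumes p: "p \<in> hyp2" and e: "e \<in> tspace p" "mink e e = 1" and v: "v \<in> tspace p"
  shows "v = mink v e *\<^sub>R e + mink v (p \<boxtimes> e) *\<^sub>R (p \<boxtimes> e)"
proof -
  have "e \<boxtimes> (e \<boxtimes> v) = - (mink v (p \<boxtimes> e) *\<^sub>R (e \<boxtimes> p))"
    using mcross_tspace[OF p e(1) v] by (simp add: mcross.scaleR_right mcross.minus_right mink_sym[of v])
  then show ?thesis
    using e(2) mcross_swap[of e p] by (simp add: mcross_mcross mink_sym[of v] algebra_simps)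
qed

lemma ex_unit_tspace:
  assumes p: "p \<in> hyp2"
  obtains e where "e \<in> tspace p" "mink e e = 1"
proof -
  define w :: "real ^ 3" where "w = vector [p $ 2, p $ 1, 0]"
  have w: "w \<in> tspace p"
    by (simp add: w_def tspace_def mink_def)
  have "w \<noteq> 0"
    using p by (auto simp: w_def hyp2_def vec_eq_iff forall_3)
  then have "mink w w > 0"
    using mink_eq_0_imp_eq_0[OF p w] mink_tspace_nonneg(2)[OF p w] by fastforce
  then show thesis
    using w by (intro that[of "(1 / sqrt (mink w w)) *\<^sub>R w"]) (simp_all add: tspace_def mink_simps)
qed

section \<open>Divergence and the pullback of the symplectic form\<close>

lemma divergence_frame:
  assumes p: "p \<in> hyp2" and V: "V differentiable at p within hyp2"
    and e: "e \<in> tspace p" "mink e e = 1"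
  shows "divergence V p = mink (lc_conn V p e) e + mink (lc_conn V p (p \<boxtimes> e)) (p \<boxtimes> e)"
proof -
  let ?f = "p \<boxtimes> e" and ?A = "lc_conn V p"
  have ef: "mink e ?f = 0" "mink ?f ?f = 1" "?f \<in> tspace p"
    using mink_cpx_cpx[OF p e(1), of e] e by (simp_all add: mink_mcross_self cpx_in_tspace)
  have ne: "e \<noteq> ?f" "e \<noteq> 0"
    using ef e by (auto simp: mink_simps)
  have "?f \<notin> span {e}"
    using ef by (auto simp: span_singleton mink_simps)
  then have ind: "independent {e, ?f}"
    using ne by (simp add: independent_insert insert_commute[of e])
  have span: "span {e, ?f} = tspace p"
  proof
    have "subspace (tspace p)"
      by (auto simp: subspace_def tspace_def mink_simps)
    then show "span {e, ?f} \<subseteq> tspace p"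
      using e ef by (intro span_minimal) auto
    show "tspace p \<subseteq> span {e, ?f}"
    proof
      fix v assume "v \<in> tspace p"
      then have v: "v = mink v e *\<^sub>R e + mink v ?f *\<^sub>R ?f"
        by (rule tspace_expansion[OF p e])
      show "v \<in> span {e, ?f}"
        by (subst v) (intro span_add span_scale span_base, simp_all)
    qed
  qed
  have rep: "representation {e, ?f} v e = mink v e" "representation {e, ?f} v ?f = mink v ?f"
    if v: "v \<in> tspace p" for v
  proof -
    have "representation {e, ?f} v = representation {e, ?f} (mink v e *\<^sub>R e + mink v ?f *\<^sub>R ?f)"
      by (rule arg_cong[OF tspace_expansion[OF p e v]])
    also have "\<dots> = (\<lambda>b. mink v e * representation {e, ?f} e b + mink v ?f * representation {e, ?f} ?f b)"
      by (simp add: representation_add[OF ind] representation_scale[OF ind] span_base span_scale)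
    finally show "representation {e, ?f} v e = mink v e" "representation {e, ?f} v ?f = mink v ?f"
      using ne by (auto simp: representation_basis[OF ind])
  qed
  have "divergence V p = (\<Sum>b\<in>{e, ?f}. representation {e, ?f} (?A b) b)"
    unfolding divergence_def
    by (rule trace_on_basis[OF linear_lc_conn[OF V] _ ind span]) (auto simp: lc_conn_tspace[OF p])
  then show ?thesis
    using ne by (simp add: rep lc_conn_tspace[OF p])
qed

lemma pullback_Omega_eq:
  assumes p: "p \<in> hyp2" and V: "V differentiable at p within hyp2" "\<forall>q\<in>hyp2. V q \<in> tspace q"
    and w: "w1 \<in> tspace p" "w2 \<in> tspace p"
  shows "pullback_Omega V p w1 w2 = mink (p \<boxtimes> w1) (lc_conn V p w2) - mink (lc_conn V p w1) (p \<boxtimes> w2)"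
proof -
  have "inv_into (tspace p \<times> tspace p) (tb_iso p (V p)) (dhyp (\<lambda>q. (q, V q)) p w) = (w, lc_conn V p w)"
    if "w \<in> tspace p" for w
  proof -
    have sec: "dhyp (\<lambda>q. (q, V q)) p w = tb_iso p (V p) (w, lc_conn V p w)"
      by (rule dhyp_section[OF p that V(1)]) (simp add: V(2))
    show ?thesis
      unfolding sec
      by (rule inv_into_f_f[OF inj_tb_iso]) (simp_all add: p V(2) that lc_conn_tspace[OF p])
  qed
  then show ?thesis
    using w by (simp add: pullback_Omega_def Omega_def cpx_def)
qed

text \<open>
  Both sides are alternating bilinear forms on a plane, hence proportional; on \<open>e, p \<boxtimes> e\<close> the left-hand
  side is the trace of the covariant derivative, and the area form \<open>mink (p \<boxtimes> w1) w2\<close> is 1.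
\<close>

lemma pullback_Omega_eq_divergence:
  assumes p: "p \<in> hyp2" and V: "V differentiable at p within hyp2" "\<forall>q\<in>hyp2. V q \<in> tspace q"
    and w: "w1 \<in> tspace p" "w2 \<in> tspace p"
  shows "pullback_Omega V p w1 w2 = divergence V p * mink (p \<boxtimes> w1) w2"
proof -
  obtain e where e: "e \<in> tspace p" "mink e e = 1"
    using ex_unit_tspace[OF p] .
  define f where "f = p \<boxtimes> e"
  define A where "A = lc_conn V p"
  have lin: "linear A"
    unfolding A_def by (rule linear_lc_conn[OF V(1)])
  have f: "p \<boxtimes> f = - e" "mink e f = 0" "mink f e = 0" "mink f f = 1"
    using e mink_cpx_cpx[OF p e(1), of e]
    by (simp_all add: f_def cpx_cpx[OF p] mink_mcross_self mink_sym[of "p \<boxtimes> e" e])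
  define a b c d where "a = mink w1 e" "b = mink w1 f" "c = mink w2 e" "d = mink w2 f"
  have w: "w1 = a *\<^sub>R e + b *\<^sub>R f" "w2 = c *\<^sub>R e + d *\<^sub>R f"
    unfolding a_b_c_d_def f_def by (rule tspace_expansion[OF p e w(1)], rule tspace_expansion[OF p e w(2)])
  have Aw: "A (x *\<^sub>R e + y *\<^sub>R f) = x *\<^sub>R A e + y *\<^sub>R A f" for x y
    by (simp add: linear_add[OF lin] linear_cmul[OF lin])
  have pw: "p \<boxtimes> (x *\<^sub>R e + y *\<^sub>R f) = x *\<^sub>R f - y *\<^sub>R e" for x y
    by (simp add: mcross.add_right mcross.scaleR_right f f_def[symmetric])
  have "pullback_Omega V p w1 w2 = (a * d - b * c) * (mink (A e) e + mink (A f) f)"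
    unfolding pullback_Omega_eq[OF assms] A_def[symmetric] unfolding w Aw pw
    by (simp add: mink_simps mink_sym[of e "A _"] mink_sym[of f "A _"] algebra_simps)
  also have "mink (p \<boxtimes> w1) w2 = a * d - b * c"
    unfolding w pw using e f by (simp add: mink_simps algebra_simps)
  ultimately show ?thesis
    unfolding A_def f_def divergence_frame[OF p V(1) e] by simp
qed

lemma divergence_free_iff_Lagrangian:
  assumes p: "p \<in> hyp2" and V: "V differentiable at p within hyp2" "\<forall>q\<in>hyp2. V q \<in> tspace q"
  shows "(\<forall>w1\<in>tspace p. \<forall>w2\<in>tspace p. pullback_Omega V p w1 w2 = 0) \<longleftrightarrow> divergence V p = 0"
proof
  assume *: "\<forall>w1\<in>tspace p. \<forall>w2\<in>tspace p. pullback_Omega V p w1 w2 = 0"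
  obtain e where e: "e \<in> tspace p" "mink e e = 1"
    using ex_unit_tspace[OF p] .
  have "mink (p \<boxtimes> e) (p \<boxtimes> e) = 1"
    using mink_cpx_cpx[OF p e(1), of e] e by simp
  then show "divergence V p = 0"
    using pullback_Omega_eq_divergence[OF p V e(1) cpx_in_tspace[of p e]] * e(1) cpx_in_tspace[of p e] by simp
next
  assume "divergence V p = 0"
  then show "\<forall>w1\<in>tspace p. \<forall>w2\<in>tspace p. pullback_Omega V p w1 w2 = 0"
    by (simp add: pullback_Omega_eq_divergence[OF p V])
qed

section \<open>A global chart of the hyperbolic plane\<close>

definition spatial :: "real ^ 2 \<Rightarrow> real ^ 3" where
  "spatial h = vector [0, h $ 1, h $ 2]"

text \<open>
  The hyperboloid as a graph over the plane of its last two coordinates: as the parameter domain is the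
  whole plane, closed forms on it have potentials.
\<close>

definition chart :: "real ^ 2 \<Rightarrow> real ^ 3" where
  "chart y = sqrt (1 + y \<bullet> y) *\<^sub>R axis 1 1 + spatial y"

definition unchart :: "real ^ 3 \<Rightarrow> real ^ 2" where
  "unchart p = vector [p $ 2, p $ 3]"

definition dchart :: "real ^ 2 \<Rightarrow> real ^ 2 \<Rightarrow> real ^ 3" where
  "dchart y h = ((y \<bullet> h) / sqrt (1 + y \<bullet> y)) *\<^sub>R axis 1 1 + spatial h"

lemma inner_vec2: "(x :: real ^ 2) \<bullet> y = x $ 1 * y $ 1 + x $ 2 * y $ 2"
  by (simp add: inner_vec_def sum_2)

lemma one_plus_inner_pos: "1 + (y :: real ^ 2) \<bullet> y > 0"
  by (simp add: add_pos_nonneg)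

lemma bounded_linear_spatial: "bounded_linear spatial"
  unfolding linear_conv_bounded_linear[symmetric] linear_iff
  by (simp add: spatial_def vec_eq_iff forall_3)

lemma bounded_linear_unchart: "bounded_linear unchart"
  unfolding linear_conv_bounded_linear[symmetric] linear_iff
  by (simp add: unchart_def vec_eq_iff forall_2)

lemma chart_nth: "chart y $ 1 = sqrt (1 + y \<bullet> y)" "chart y $ 2 = y $ 1" "chart y $ 3 = y $ 2"
  by (simp_all add: chart_def spatial_def axis_def)

lemma dchart_nth: "dchart y h $ 1 = (y \<bullet> h) / sqrt (1 + y \<bullet> y)" "dchart y h $ 2 = h $ 1" "dchart y h $ 3 = h $ 2"
  by (simp_all add: dchart_def spatial_def axis_def)

lemma chart_in_hyp2: "chart y \<in> hyp2"
proof -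
  have "sqrt (1 + y \<bullet> y) * sqrt (1 + y \<bullet> y) = 1 + y \<bullet> y"
    using one_plus_inner_pos[of y] by simp
  then show ?thesis
    using one_plus_inner_pos[of y] by (simp add: hyp2_def mink_def chart_nth inner_vec2)
qed

lemma unchart_chart [simp]: "unchart (chart y) = y"
  by (simp add: unchart_def chart_nth vec_eq_iff forall_2)

lemma chart_unchart:
  assumes "p \<in> hyp2"
  shows "chart (unchart p) = p"
proof -
  have "1 + unchart p \<bullet> unchart p = (p $ 1)\<^sup>2" "p $ 1 > 0"
    using assms by (simp_all add: hyp2_def mink_def unchart_def inner_vec2 power2_eq_square)
  then show ?thesis
    by (simp add: vec_eq_iff forall_3 chart_nth) (simp add: unchart_def)
qed

lemma dchart_in_tspace: "dchart y h \<in> tspace (chart y)"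
  using one_plus_inner_pos[of y] by (simp add: tspace_def mink_def dchart_nth chart_nth inner_vec2)

lemma dchart_unchart:
  assumes "w \<in> tspace (chart y)"
  shows "dchart y (unchart w) = w"
proof -
  have "sqrt (1 + y \<bullet> y) * w $ 1 = y \<bullet> unchart w"
    using assms by (simp add: tspace_def mink_def chart_nth unchart_def inner_vec2)
  then show ?thesis
    using one_plus_inner_pos[of y]
    by (simp add: vec_eq_iff forall_3 dchart_nth field_simps) (simp add: unchart_def)
qed

lemma linear_dchart: "linear (dchart y)"
  unfolding dchart_def
  by (intro linearI) (simp_all add: linear_simps[OF bounded_linear_spatial] algebra_simps inner_add_right add_divide_distrib)

lemma sqrt_has_derivative:
  "((\<lambda>y :: real ^ 2. sqrt (1 + y \<bullet> y)) has_derivative (\<lambda>h. (y \<bullet> h) / sqrt (1 + y \<bullet> y))) (at y)"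
proof -
  have "((\<lambda>y :: real ^ 2. 1 + y \<bullet> y) has_derivative (\<lambda>h. 0 + (y \<bullet> h + h \<bullet> y))) (at y)"
    by (rule has_derivative_add[OF has_derivative_const has_derivative_inner[OF has_derivative_ident has_derivative_ident]])
  then have "((\<lambda>y :: real ^ 2. sqrt (1 + y \<bullet> y)) has_derivative
      (\<lambda>h. (0 + (y \<bullet> h + h \<bullet> y)) * (inverse (sqrt (1 + y \<bullet> y)) / 2))) (at y)"
    by (rule DERIV_compose_FDERIV[where f = sqrt and g = "\<lambda>y. 1 + y \<bullet> y", OF DERIV_real_sqrt[OF one_plus_inner_pos]])
  moreover have "(0 + (y \<bullet> h + h \<bullet> y)) * (inverse (sqrt (1 + y \<bullet> y)) / 2) = (y \<bullet> h) / sqrt (1 + y \<bullet> y)" for h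
    unfolding inner_commute[of h y] inverse_eq_divide by simp
  ultimately show ?thesis
    by simp
qed

lemma chart_has_derivative: "(chart has_derivative dchart y) (at y)"
  unfolding chart_def[abs_def] dchart_def
  by (rule has_derivative_add[OF has_derivative_scaleR_left[OF sqrt_has_derivative]
        bounded_linear_imp_has_derivative[OF bounded_linear_spatial]])

text \<open>
  The reciprocal of the coordinate \<open>x\<^sub>0\<close> on the hyperboloid. Its derivative is a polynomial in itself and
  linear functions, so that its smoothness follows by induction from closure under products alone, and
  with it the smoothness of the chart.
\<close>

definition inv_height :: "real ^ 2 \<Rightarrow> real" where
  "inv_height y = 1 / sqrt (1 + y \<bullet> y)"

lemma inv_height_has_derivative:
  "(inv_height has_derivative (\<lambda>h. - (y \<bullet> h) * (inv_height y * (inv_height y * inv_height y)))) (at y)"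
proof -
  define s where "s = sqrt (1 + y \<bullet> y)"
  have s: "s > 0" using one_plus_inner_pos[of y] by (simp add: s_def)
  have "((\<lambda>y. 1 / sqrt (1 + y \<bullet> y)) has_derivative (\<lambda>h. (0 * s - 1 * ((y \<bullet> h) / s)) / (s * s))) (at y)"
    using has_derivative_divide'[OF has_derivative_const[of 1] sqrt_has_derivative[of y]] s
    unfolding s_def by simp
  then show ?thesis
    unfolding inv_height_def[abs_def] s_def[symmetric]
    by (rule has_derivative_eq_rhs) (simp add: fun_eq_iff)
qed

lemma Ck_on_inv_height: "Ck_on k UNIV inv_height"
proof (induction k)
  case 0
  have "isCont inv_height y" for y
    using inv_height_has_derivative by (rule has_derivative_continuous)
  then show ?case
    unfolding Ck_on.simps(1) by (simp add: continuous_at_imp_continuous_on)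
next
  case (Suc k)
  have cube: "Ck_on k UNIV (\<lambda>y. inv_height y * (inv_height y * inv_height y))"
    by (rule Ck_on_bilinear[OF bounded_bilinear_mult open_UNIV Suc.IH],
        rule Ck_on_bilinear[OF bounded_bilinear_mult open_UNIV Suc.IH Suc.IH])
  have "Ck_on k UNIV (\<lambda>y. - (y \<bullet> v))" for v :: "real ^ 2"
    by (rule Ck_on_bounded_linear[OF open_UNIV bounded_linear_minus[OF bounded_linear_inner_left]])
  from Ck_on_bilinear[OF bounded_bilinear_mult open_UNIV this cube]
  show ?case
    by (rule Ck_on_SucI[OF open_UNIV inv_height_has_derivative])
qed

lemma dchart_has_derivative:
  "((\<lambda>y. dchart y h) has_derivative
     (\<lambda>k. ((y \<bullet> h) * (- (y \<bullet> k) * (inv_height y * (inv_height y * inv_height y))) + (k \<bullet> h) * inv_height y) *\<^sub>R axis 1 1)) (at y)"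
proof -
  have "((\<lambda>y. y \<bullet> h) has_derivative (\<lambda>k. k \<bullet> h)) (at y)"
    by (rule bounded_linear_imp_has_derivative[OF bounded_linear_inner_left])
  note has_derivative_mult[OF this inv_height_has_derivative]
  note has_derivative_add[OF has_derivative_scaleR_left[OF this, of "axis 1 1"] has_derivative_const[of "spatial h"]]
  moreover have "dchart y h = ((y \<bullet> h) * inv_height y) *\<^sub>R axis 1 1 + spatial h" for y
    by (simp add: dchart_def inv_height_def)
  ultimately show ?thesis
    by (simp only: add_0_right)
qed

lemma Ck_on_dchart: "Ck_on k UNIV (\<lambda>y. dchart y h)"
proof -
  have "Ck_on k UNIV (\<lambda>y. y \<bullet> h)"
    by (rule Ck_on_bounded_linear[OF open_UNIV bounded_linear_inner_left])
  note Ck_on_bilinear[OF bounded_bilinear_mult open_UNIV this Ck_on_inv_height]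
  note Ck_on_bilinear[OF bounded_bilinear_scaleR open_UNIV this Ck_on_const[OF open_UNIV, of k "axis 1 1"]]
  from Ck_on_add[OF open_UNIV this Ck_on_const[OF open_UNIV, of k "spatial h"]]
  show ?thesis
    by (simp add: dchart_def inv_height_def)
qed

lemma Ck_on_chart: "Ck_on k UNIV chart"
proof (cases k)
  case 0
  show ?thesis
    unfolding 0 Ck_on.simps(1)
    by (intro continuous_at_imp_continuous_on ballI has_derivative_continuous[OF chart_has_derivative])
next
  case (Suc n)
  show ?thesis
    unfolding Suc by (rule Ck_on_SucI[OF open_UNIV chart_has_derivative Ck_on_dchart])
qed

section \<open>The flux form of a vector field\<close>

text \<open>
  The 1-form \<open>w \<mapsto> g(V, J w)\<close>, pulled back by the chart and turned into a vector field by the Euclidean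
  inner product (lemma \<open>flux_inner\<close>). Up to sign it is the area form contracted with \<open>V\<close>, which measures
  the flux of \<open>V\<close> across curves.
\<close>

definition flux :: "(real ^ 3 \<Rightarrow> real ^ 3) \<Rightarrow> real ^ 2 \<Rightarrow> real ^ 2" where
  "flux V y = (\<Sum>b\<in>Basis. mink (V (chart y)) (chart y \<boxtimes> dchart y b) *\<^sub>R b)"

lemma inner_sum_Basis:
  fixes h :: "'a::euclidean_space"
  assumes "linear l"
  shows "(\<Sum>b\<in>Basis. l b *\<^sub>R b) \<bullet> h = l h"
proof -
  have "l h = l (\<Sum>b\<in>Basis. (h \<bullet> b) *\<^sub>R b)"
    by (simp only: euclidean_representation)
  also have "\<dots> = (\<Sum>b\<in>Basis. (h \<bullet> b) * l b)"
    by (simp only: linear_sum[OF assms] linear_cmul[OF assms] real_scaleR_def)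
  finally show ?thesis
    by (simp add: inner_sum_left inner_commute[of h] mult.commute)
qed

lemma flux_inner: "flux V y \<bullet> h = mink (V (chart y)) (chart y \<boxtimes> dchart y h)"
  unfolding flux_def
  by (rule inner_sum_Basis)
     (intro linearI, simp_all add: linear_add[OF linear_dchart] linear_cmul[OF linear_dchart]
        mcross.add_right mcross.scaleR_right mink_simps)

text \<open>
  The left-hand side is the exterior derivative of the flux form. The product rule splits the derivative of
  \<open>g(V, p \<boxtimes> dp)\<close> into three terms. The one with the second derivative of the chart is symmetric
  and cancels; the one where the first factor \<open>p\<close> is differentiated is a triple product of tangent
  vectors and vanishes; the one with the derivative of \<open>V\<close> remains, and only its tangential part, the
  covariant derivative, is seen by the tangent vector \<open>p \<boxtimes> dp\<close>.
\<close>

lemma flux_derivative_skew: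
  assumes V: "V differentiable at (chart y) within hyp2" "\<forall>q\<in>hyp2. V q \<in> tspace q"
    and F: "(flux V has_derivative F) (at y)"
  shows "F h \<bullet> k - F k \<bullet> h = - pullback_Omega V (chart y) (dchart y h) (dchart y k)"
proof -
  define p where "p = chart y"
  note p = chart_in_hyp2[of y, folded p_def]
  define A where "A = lc_conn V p"
  define ddchart where "ddchart = (\<lambda>k h. ((y \<bullet> h) * (- (y \<bullet> k) * (inv_height y * (inv_height y * inv_height y))) + (k \<bullet> h) * inv_height y)
      *\<^sub>R (axis 1 1 :: real ^ 3))"
  have "(V has_derivative dhyp V p) (at p within hyp2)"
    using V(1) unfolding dhyp_def frechet_derivative_works p_def .
  then have "(V has_derivative dhyp V p) (at (chart y) within range chart)"
    unfolding p_def by (rule has_derivative_subset) (use chart_in_hyp2 in auto)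
  from diff_chain_within[OF chart_has_derivative this]
  have dV: "((\<lambda>y. V (chart y)) has_derivative (\<lambda>h. dhyp V p (dchart y h))) (at y)"
    by (simp add: o_def)
  have F_eq: "F h \<bullet> k = mink (V p) (p \<boxtimes> ddchart h k + dchart y h \<boxtimes> dchart y k)
      + mink (dhyp V p (dchart y h)) (p \<boxtimes> dchart y k)" for h k
  proof -
    have "((\<lambda>y. flux V y \<bullet> k) has_derivative (\<lambda>h. F h \<bullet> k)) (at y)"
      by (rule has_derivative_inner_left[OF F])
    moreover have "((\<lambda>y. mink (V (chart y)) (chart y \<boxtimes> dchart y k)) has_derivative
        (\<lambda>h. mink (V (chart y)) (chart y \<boxtimes> ddchart h k + dchart y h \<boxtimes> dchart y k)
          + mink (dhyp V p (dchart y h)) (chart y \<boxtimes> dchart y k))) (at y)"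
      unfolding ddchart_def
      by (rule mink.FDERIV[OF dV mcross.FDERIV[OF chart_has_derivative dchart_has_derivative]])
    ultimately show ?thesis
      unfolding flux_inner p_def[symmetric] by (rule has_derivative_unique[THEN fun_cong])
  qed
  have tangent: "dchart y h \<in> tspace p" for h
    unfolding p_def by (rule dchart_in_tspace)
  have normal: "mink (V p) (dchart y h \<boxtimes> dchart y k) = 0" for h k
    using p V(2) tangent by (intro mink_mcross_tspace_eq_0) auto
  have conn: "mink (dhyp V p a) (p \<boxtimes> b) = mink (A a) (p \<boxtimes> b)" for a b
    by (simp add: A_def lc_conn_def tang_def mink_simps mink_mcross_self)
  have sym: "ddchart h k = ddchart k h"
    by (simp add: ddchart_def inner_commute[of h k] mult_ac)
  show ?thesis
    unfolding F_eq p_def[symmetric] pullback_Omega_eq[OF p V(1)[folded p_def] V(2) tangent tangent]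
    by (simp add: conn normal mink.add_right sym A_def mink_sym[of "p \<boxtimes> _"])
qed

section \<open>Tangent planes in the Klein model\<close>

lemma klein_coordinates:
  shows "klein_proj (chart y) = (1 / sqrt (1 + y \<bullet> y)) *\<^sub>R y"
    and "klein_proj (chart y) \<in> ball 0 1"
    and "chart y = sqrt (1 + y \<bullet> y) *\<^sub>R vector [1, klein_proj (chart y) $ 1, klein_proj (chart y) $ 2]"
    and "u (chart y) = sqrt (1 + y \<bullet> y) * klein_fun u (klein_proj (chart y))"
proof -
  note pos = one_plus_inner_pos[of y]
  show 1: "klein_proj (chart y) = (1 / sqrt (1 + y \<bullet> y)) *\<^sub>R y"
    by (simp add: klein_proj_def chart_nth vec_eq_iff forall_2)
  show "klein_proj (chart y) \<in> ball 0 1"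
    using bij_betw_klein_proj chart_in_hyp2 by (rule bij_betwE[THEN bspec])
  show "chart y = sqrt (1 + y \<bullet> y) *\<^sub>R vector [1, klein_proj (chart y) $ 1, klein_proj (chart y) $ 2]"
    using pos by (simp add: 1 vec_eq_iff forall_3 chart_nth)
  have "1 - (norm (klein_proj (chart y)))\<^sup>2 = 1 / (1 + y \<bullet> y)"
    unfolding 1 power2_norm_eq_inner using pos by (simp add: field_simps)
  moreover have "inv_into hyp2 klein_proj (klein_proj (chart y)) = chart y"
    using bij_betw_klein_proj chart_in_hyp2 by (auto simp: bij_betw_def)
  ultimately show "u (chart y) = sqrt (1 + y \<bullet> y) * klein_fun u (klein_proj (chart y))"
    using pos by (simp add: klein_fun_def real_sqrt_divide)
qed

text \<open>
  Inverting \<open>klein_coordinates\<close>: with \<open>s = sqrt (1 - \<eta> \<bullet> \<eta>)\<close>, the point of the hyperboloid over \<open>\<eta>\<close> has the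
  chart coordinate \<open>\<eta> / s\<close>.
\<close>

lemma klein_fun_differentiable:
  assumes u: "\<And>y. (\<lambda>y. u (chart y)) differentiable at y" and \<eta>: "\<eta> \<in> ball 0 1"
  shows "klein_fun u differentiable at \<eta>"
proof -
  define s where "s = (\<lambda>\<eta>::real ^ 2. sqrt (1 - \<eta> \<bullet> \<eta>))"
  have pos: "1 - \<eta> \<bullet> \<eta> > 0" if "\<eta> \<in> ball 0 1" for \<eta> :: "real ^ 2"
    using that by (simp add: power_less_one_iff flip: power2_norm_eq_inner)
  have eq: "s \<eta> * u (chart ((1 / s \<eta>) *\<^sub>R \<eta>)) = klein_fun u \<eta>" if "\<eta> \<in> ball 0 1" for \<eta>
  proof -
    define y where "y = (1 / s \<eta>) *\<^sub>R \<eta>"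
    have "1 + y \<bullet> y = 1 / (1 - \<eta> \<bullet> \<eta>)"
      using pos[OF that] by (simp add: y_def s_def field_simps)
    then have q: "sqrt (1 + y \<bullet> y) = 1 / s \<eta>"
      by (simp add: s_def real_sqrt_divide)
    have "s \<eta> > 0" using pos[OF that] by (simp add: s_def)
    then have "klein_proj (chart y) = \<eta>"
      unfolding klein_coordinates(1) q by (simp add: y_def)
    then show ?thesis
      using klein_coordinates(4)[of u y] \<open>s \<eta> > 0\<close> unfolding y_def[symmetric] q by simp
  qed
  have s: "s differentiable at \<eta>"
    unfolding s_def using pos[OF \<eta>]
    by (intro differentiableI) (auto intro!: derivative_eq_intros)
  have "(\<lambda>\<eta>. (1 / s \<eta>) *\<^sub>R \<eta>) differentiable at \<eta>"
    using pos[OF \<eta>] s by (intro derivative_intros) (auto simp: s_def)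
  then have "(\<lambda>\<eta>. u (chart ((1 / s \<eta>) *\<^sub>R \<eta>))) differentiable at \<eta>"
    by (rule differentiable_compose[OF u])
  with s have "(\<lambda>\<eta>. s \<eta> * u (chart ((1 / s \<eta>) *\<^sub>R \<eta>))) differentiable at \<eta>"
    by (rule differentiable_mult)
  then obtain D where "((\<lambda>\<eta>. s \<eta> * u (chart ((1 / s \<eta>) *\<^sub>R \<eta>))) has_derivative D) (at \<eta>)"
    by (auto simp: differentiable_def)
  from has_derivative_transform_within_open[OF this open_ball \<eta> eq]
  show ?thesis
    by (auto simp: differentiable_def)
qed

text \<open>
  Let \<open>q = x\<^sub>0\<close> and let \<open>P\<close> be the Klein projection, both in the chart. Then \<open>u = q \<cdot> (f \<circ> P)\<close> with
  \<open>f = klein_fun u\<close>, and \<open>mink _ \<sigma> = q \<cdot> (a \<circ> P)\<close> with \<open>a\<close> the affine function whose graph is the plane of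
  \<open>\<sigma>\<close>. Since \<open>f\<close> and \<open>a\<close> have the same value and derivative at \<open>P y\<close>, the two products have the same
  derivative at \<open>y\<close>, whatever the derivatives of \<open>q\<close> and \<open>P\<close> are.
\<close>

lemma derivative_eq_tangent_plane:
  assumes f: "klein_fun u differentiable at (klein_proj (chart y))"
    and \<sigma>: "plane \<sigma> = graph_tangent_plane (klein_fun u) (klein_proj (chart y))"
  shows "((\<lambda>y. u (chart y)) has_derivative (\<lambda>h. mink (dchart y h) \<sigma>)) (at y)"
proof -
  define f where "f = klein_fun u"
  define P where "P = (\<lambda>y. klein_proj (chart y))"
  define q where "q = (\<lambda>y::real ^ 2. sqrt (1 + y \<bullet> y))"
  define D where "D = frechet_derivative f (at (P y))"
  have D: "(f has_derivative D) (at (P y))"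
    using f unfolding D_def f_def P_def frechet_derivative_works .
  have affine: "mink (vector [1, P z $ 1, P z $ 2]) \<sigma> = f (P y) + D (P z - P y)" for z
  proof -
    have "(P z, mink (vector [1, P z $ 1, P z $ 2]) \<sigma>) \<in> plane \<sigma>"
      using klein_coordinates(2)[of z] by (simp add: plane_def P_def)
    then show ?thesis
      unfolding \<sigma> graph_tangent_plane_def by (simp add: f_def P_def D_def)
  qed
  have M: "(\<lambda>z. mink (chart z) \<sigma>) = (\<lambda>z. q z * (f (P y) + D (P z - P y)))"
    unfolding affine[symmetric] by (subst klein_coordinates(3)) (simp add: q_def P_def mink_simps)
  have U: "(\<lambda>z. u (chart z)) = (\<lambda>z. q z * f (P z))"
    by (subst klein_coordinates(4)) (simp add: q_def P_def f_def)
  have "q differentiable at y"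
    unfolding q_def using one_plus_inner_pos[of y]
    by (intro differentiableI) (auto intro!: derivative_eq_intros)
  then obtain Q where Q: "(q has_derivative Q) (at y)"
    by (auto simp: differentiable_def)
  have "P differentiable at y"
    unfolding P_def klein_coordinates(1) using \<open>q differentiable at y\<close> one_plus_inner_pos[of y]
    by (intro derivative_intros) (auto simp: q_def)
  then obtain K where K: "(P has_derivative K) (at y)"
    by (auto simp: differentiable_def)
  have "((\<lambda>z. q z * (f (P y) + D (P z - P y))) has_derivative
      (\<lambda>h. q y * (0 + D (K h - 0)) + Q h * (f (P y) + D (P y - P y)))) (at y)"
    by (intro has_derivative_mult Q has_derivative_add has_derivative_const has_derivative_diff K
        has_derivative_compose[OF _ bounded_linear_imp_has_derivative[OF has_derivative_bounded_linear[OF D]]])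
  moreover have "((\<lambda>z. mink (chart z) \<sigma>) has_derivative (\<lambda>h. mink (dchart y h) \<sigma>)) (at y)"
    by (rule bounded_linear.has_derivative[OF mink.bounded_linear_left chart_has_derivative])
  ultimately have "(\<lambda>h. mink (dchart y h) \<sigma>) = (\<lambda>h. q y * D (K h) + Q h * f (P y))"
    unfolding M using linear_0[OF has_derivative_linear[OF D]]
    by (auto dest: has_derivative_unique)
  moreover have "((\<lambda>z. q z * f (P z)) has_derivative (\<lambda>h. q y * D (K h) + Q h * f (P y))) (at y)"
    by (intro has_derivative_mult Q has_derivative_compose[OF K D])
  ultimately show ?thesis
    unfolding U by simp
qed

text \<open>
  By \<open>derivative_eq_tangent_plane\<close> the derivative of \<open>u\<close> is \<open>mink \<sigma> w = mink (p \<boxtimes> \<sigma>) (p \<boxtimes> w)\<close>, and the flux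
  form is \<open>mink (V p) (p \<boxtimes> w)\<close>. If they agree, then \<open>V p - p \<boxtimes> \<sigma>\<close> is a tangent vector orthogonal to the
  whole tangent plane.
\<close>

lemma assoc_field_iff_potential:
  assumes u: "\<And>y. (\<lambda>y. u (chart y)) differentiable at y" and V: "V (chart y) \<in> tspace (chart y)"
  shows "V (chart y) = assoc_field u (chart y) \<longleftrightarrow>
    ((\<lambda>y. u (chart y)) has_derivative (\<lambda>h. flux V y \<bullet> h)) (at y)"
proof -
  define p where "p = chart y"
  have p: "p \<in> hyp2" unfolding p_def by (rule chart_in_hyp2)
  define \<sigma> where "\<sigma> = (THE \<sigma>. plane \<sigma> = graph_tangent_plane (klein_fun u) (klein_proj p))"
  have diff: "klein_fun u differentiable at (klein_proj p)"
    unfolding p_def by (rule klein_fun_differentiable[OF u klein_coordinates(2)])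
  have "plane \<sigma> = graph_tangent_plane (klein_fun u) (klein_proj p)"
    unfolding \<sigma>_def by (rule theI'[OF ex1_tangent_plane[OF diff]])
  from derivative_eq_tangent_plane[OF diff[unfolded p_def] this[unfolded p_def]]
  have "((\<lambda>y. u (chart y)) has_derivative (\<lambda>h. mink \<sigma> (dchart y h))) (at y)"
    by (simp add: mink_sym)
  moreover have "mink \<sigma> (dchart y h) = mink (p \<boxtimes> \<sigma>) (p \<boxtimes> dchart y h)" for h
    using mink_cpx_cpx[OF p] dchart_in_tspace by (simp add: p_def)
  ultimately have du: "((\<lambda>y. u (chart y)) has_derivative (\<lambda>h. mink (p \<boxtimes> \<sigma>) (p \<boxtimes> dchart y h))) (at y)"
    by simp
  show ?thesis
    unfolding flux_inner p_def[symmetric]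
  proof
    assume "V p = assoc_field u p"
    then show "((\<lambda>y. u (chart y)) has_derivative (\<lambda>h. mink (V p) (p \<boxtimes> dchart y h))) (at y)"
      using du by (simp add: assoc_field_def \<sigma>_def)
  next
    assume "((\<lambda>y. u (chart y)) has_derivative (\<lambda>h. mink (V p) (p \<boxtimes> dchart y h))) (at y)"
    from fun_cong[OF has_derivative_unique[OF this du]]
    have eq: "mink (V p) (p \<boxtimes> dchart y h) = mink (p \<boxtimes> \<sigma>) (p \<boxtimes> dchart y h)" for h .
    define X where "X = V p - p \<boxtimes> \<sigma>"
    have X: "X \<in> tspace p"
      using V cpx_in_tspace[of p \<sigma>] by (simp add: X_def p_def tspace_def mink_simps)
    \<comment> \<open>the choice \<open>w = p \<boxtimes> X\<close>, for which \<open>p \<boxtimes> w = - X\<close>\<close>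
    have "mink X (p \<boxtimes> dchart y (unchart (p \<boxtimes> X))) = 0"
      unfolding X_def mink.diff_left eq by simp
    then have "mink X X = 0"
      using dchart_unchart[of "p \<boxtimes> X" y] cpx_in_tspace[of p X] cpx_cpx[OF p X]
      by (simp add: p_def[symmetric] mink_simps)
    then show "V p = assoc_field u p"
      using mink_eq_0_imp_eq_0[OF p X] by (simp add: X_def assoc_field_def \<sigma>_def)
  qed
qed

section \<open>The equivalence\<close>

lemma smooth_map_hyp2_differentiable:
  assumes "smooth_map hyp2 V" "p \<in> hyp2"
  shows "V differentiable at p within hyp2"
proof (rule smooth_mapE[OF assms])
  fix U F
  assume U: "open U" "p \<in> U" and F: "\<And>k. Ck_on k U F" "\<And>y. y \<in> hyp2 \<inter> U \<Longrightarrow> F y = V y"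
  obtain D where "(F has_derivative D) (at p)"
    using Ck_on_Suc_has_derivative[OF F(1) U(2)] by blast
  then have D: "(F has_derivative D) (at p within hyp2)"
    by (rule has_derivative_at_withinI)
  obtain d where "d > 0" "ball p d \<subseteq> U"
    using U by (meson open_contains_ball)
  then have "(V has_derivative D) (at p within hyp2)"
    by (intro has_derivative_transform_within[OF D _ assms(2)] F(2)) (auto simp: dist_commute)
  then show ?thesis
    by (auto simp: differentiable_def)
qed

lemma Ck_on_flux:
  assumes "smooth_map hyp2 V"
  shows "Ck_on k UNIV (flux V)"
proof -
  have V: "Ck_on k UNIV (\<lambda>y. V (chart y))"
    by (rule smooth_map_compose_Ck_on[OF assms open_UNIV Ck_on_chart]) (use chart_in_hyp2 in auto)
  have "Ck_on k UNIV (\<lambda>y. mink (V (chart y)) (chart y \<boxtimes> dchart y b) *\<^sub>R b)" for b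
    by (rule Ck_on_bilinear[OF bounded_bilinear_scaleR open_UNIV _ Ck_on_const[OF open_UNIV]],
        rule Ck_on_bilinear[OF bounded_bilinear_mink open_UNIV V],
        rule Ck_on_bilinear[OF bounded_bilinear_mcross open_UNIV Ck_on_chart Ck_on_dchart])
  then show ?thesis
    unfolding flux_def[abs_def] by (intro Ck_on_sum[OF open_UNIV])
qed

text \<open>
  A potential of the flux form makes its derivative symmetric, that is, the pullback of \<open>\<Omega>\<close> zero; the
  Poincare lemma gives the converse. The potential found on the plane is carried back by \<open>unchart\<close>, which
  is linear on the whole ambient space, so it comes with a global smooth extension.
\<close>

lemma assoc_field_iff_Lagrangian:
  assumes V: "smooth_field V"
  shows "(\<exists>u :: real ^ 3 \<Rightarrow> real. smooth_map hyp2 u \<and> (\<forall>p\<in>hyp2. V p = assoc_field u p)) \<longleftrightarrow>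
    (\<forall>p\<in>hyp2. \<forall>w1\<in>tspace p. \<forall>w2\<in>tspace p. pullback_Omega V p w1 w2 = 0)"
proof -
  have smooth: "smooth_map hyp2 V" and tangent: "\<forall>p\<in>hyp2. V p \<in> tspace p"
    using V by (simp_all add: smooth_field_def)
  note diff = smooth_map_hyp2_differentiable[OF smooth chart_in_hyp2]
  define F where "F = (\<lambda>y. frechet_derivative (flux V) (at y))"
  have F: "(flux V has_derivative F y) (at y)" for y
    unfolding F_def by (rule Ck_on_Suc_has_derivative[OF Ck_on_flux[OF smooth] UNIV_I])
  note skew = flux_derivative_skew[OF diff tangent F]
  show ?thesis
  proof
    assume "\<exists>u :: real ^ 3 \<Rightarrow> real. smooth_map hyp2 u \<and> (\<forall>p\<in>hyp2. V p = assoc_field u p)"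
    then obtain u :: "real ^ 3 \<Rightarrow> real" where u: "smooth_map hyp2 u" "\<forall>p\<in>hyp2. V p = assoc_field u p"
      by blast
    have "Ck_on (Suc 0) UNIV (\<lambda>y. u (chart y))"
      by (rule smooth_map_compose_Ck_on[OF u(1) open_UNIV Ck_on_chart]) (use chart_in_hyp2 in auto)
    then have "(\<lambda>y. u (chart y)) differentiable at y" for y
      by simp
    then have du: "((\<lambda>y. u (chart y)) has_derivative (\<lambda>h. flux V y \<bullet> h)) (at y)" for y
      using assoc_field_iff_potential[of u V y] u(2) tangent chart_in_hyp2 by blast
    have "F y h \<bullet> k = F y k \<bullet> h" for y h k
      by (rule symmetric_derivative_of_gradient[OF du F])
    then have chart0: "pullback_Omega V (chart y) (dchart y h) (dchart y k) = 0" for y h k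
      using skew[of y h k] by simp
    show "\<forall>p\<in>hyp2. \<forall>w1\<in>tspace p. \<forall>w2\<in>tspace p. pullback_Omega V p w1 w2 = 0"
    proof (intro ballI)
      fix p w1 w2 assume *: "p \<in> hyp2" "w1 \<in> tspace p" "w2 \<in> tspace p"
      show "pullback_Omega V p w1 w2 = 0"
        using chart0[of "unchart p" "unchart w1" "unchart w2"] *
        by (simp add: chart_unchart dchart_unchart)
    qed
  next
    assume L: "\<forall>p\<in>hyp2. \<forall>w1\<in>tspace p. \<forall>w2\<in>tspace p. pullback_Omega V p w1 w2 = 0"
    have "F y h \<bullet> k = F y k \<bullet> h" for y h k
      using skew[of y h k] L chart_in_hyp2 dchart_in_tspace by simp
    moreover have "continuous_on UNIV (\<lambda>y. F y v)" for v
      using Ck_on_flux[OF smooth, of "Suc 0"] by (simp add: F_def)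
    ultimately obtain w where w: "\<And>y. (w has_derivative (\<lambda>h. flux V y \<bullet> h)) (at y)"
      using Poincare_lemma[OF F] by blast
    define u where "u = (\<lambda>p. w (unchart p))"
    have uw: "(\<lambda>y. u (chart y)) = w"
      by (simp add: u_def)
    have "Ck_on k UNIV (\<lambda>y. flux V y \<bullet> v)" for k v
      by (rule Ck_on_bilinear[OF bounded_bilinear_inner open_UNIV Ck_on_flux[OF smooth] Ck_on_const[OF open_UNIV]])
    then have "Ck_on (Suc k) UNIV w" for k
      by (rule Ck_on_SucI[OF open_UNIV w])
    then have "Ck_on k UNIV w" for k
      by (rule Ck_on_Suc_imp_Ck_on)
    then have "Ck_on k UNIV u" for k
      unfolding u_def
      by (rule Ck_on_compose[OF open_UNIV _ Ck_on_bounded_linear[OF open_UNIV bounded_linear_unchart], rotated]) simp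
    then have "smooth_map hyp2 u"
      unfolding smooth_map_def by (intro ballI exI[of _ UNIV] exI[of _ u]) simp
    moreover have "V p = assoc_field u p" if p: "p \<in> hyp2" for p
    proof -
      have "w differentiable at y" for y
        using w by (auto simp: differentiable_def)
      then have "V (chart (unchart p)) = assoc_field u (chart (unchart p))"
        using assoc_field_iff_potential[of u V "unchart p"] tangent chart_in_hyp2 w uw by simp
      then show ?thesis
        by (simp add: chart_unchart[OF p])
    qed
    ultimately show "\<exists>u :: real ^ 3 \<Rightarrow> real. smooth_map hyp2 u \<and> (\<forall>p\<in>hyp2. V p = assoc_field u p)"
      by blast
  qed
qed

theorem theorem1p1:
  fixes V :: "real ^ 3 \<Rightarrow> real ^ 3"
  assumes "smooth_field V"
  shows "((\<exists>u :: real ^ 3 \<Rightarrow> real. smooth_map hyp2 u \<and> (\<forall>p\<in>hyp2. V p = assoc_field u p)) \<longleftrightarrow>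
          (\<forall>p\<in>hyp2. \<forall>w1\<in>tspace p. \<forall>w2\<in>tspace p. pullback_Omega V p w1 w2 = 0)) \<and>
         ((\<forall>p\<in>hyp2. \<forall>w1\<in>tspace p. \<forall>w2\<in>tspace p. pullback_Omega V p w1 w2 = 0) \<longleftrightarrow>
          (\<forall>p\<in>hyp2. divergence V p = 0))"
proof (rule conjI)
  show "(\<exists>u :: real ^ 3 \<Rightarrow> real. smooth_map hyp2 u \<and> (\<forall>p\<in>hyp2. V p = assoc_field u p)) \<longleftrightarrow>
      (\<forall>p\<in>hyp2. \<forall>w1\<in>tspace p. \<forall>w2\<in>tspace p. pullback_Omega V p w1 w2 = 0)"
    by (rule assoc_field_iff_Lagrangian[OF assms])
  have "smooth_map hyp2 V" "\<forall>q\<in>hyp2. V q \<in> tspace q"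
    using assms by (simp_all add: smooth_field_def)
  then show "(\<forall>p\<in>hyp2. \<forall>w1\<in>tspace p. \<forall>w2\<in>tspace p. pullback_Omega V p w1 w2 = 0) \<longleftrightarrow>
      (\<forall>p\<in>hyp2. divergence V p = 0)"
    by (intro ball_cong refl divergence_free_iff_Lagrangian smooth_map_hyp2_differentiable)
qed

end
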